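(* Let $0<\alpha<1$, $\Lambda>0$ be fixed. Set $I=[a,b]$, $0<a<b<1$. For $v_0\in I$, let $(c(v_0),R(v_0),v(v_0;\xi))$ denote the unique solution of the free boundary problem $$\begin{cases}\Lambda v''(\xi)-cv'(\xi)=v^\alpha(\xi),\quad 0<\xi<R,\\ v(0)=v_0,\quad v'(0)=-\dfrac{c}{\Lambda}(1-v_0),\\ v(R)=v'(R)=0.\end{cases}$$ (i) There exists a finite $R_{max}$ depending only upon $\alpha$, $\Lambda$, $a$ and $b$ such that $0<R(v_0)\le R_{max}$ for all $v_0\in I$. (ii) The mapping $v_0\mapsto (c(v_0),R(v_0),\widetilde v(v_0))$ from $I$ to $(\mathbb{R}^+)^2\times C^1([0,R_{max}])$ is continuous, where $\widetilde v(v_0;\xi)$ is the extension by $0$ of the function $v(v_0;\xi)$ to the interval $[0,R_{max}]$.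
   Context: For each $v_0\in(0,1)$ the free boundary problem has a unique solution $(c,R,v)$ with $c>0$, $0<R<+\infty$, $v\ge 0$, $v\in C^\infty([0,R))\cap C^{2+[\beta],\beta-[\beta]}([0,R])$, where $\beta=2\alpha/(1-\alpha)$ and $[\beta]$ is the integer part of $\beta$; this is the solution denoted $(c(v_0),R(v_0),v(v_0;\cdot))$. *)

theory Defs
  imports "HOL-Analysis.Analysis"
begin

section \<open>Differentiability classes on real intervals\<close>

text \<open>
  All derivatives are taken relative to the set \<open>S\<close>, hence are one-sided at those endpoints of an
  interval that belong to it; values of the function outside \<open>S\<close> are irrelevant.
\<close>

definition nth_deriv_on :: "real set \<Rightarrow> nat \<Rightarrow> (real \<Rightarrow> real) \<Rightarrow> real \<Rightarrow> real" where
  "nth_deriv_on S k f = ((\<lambda>g x. vector_derivative g (at x within S)) ^^ k) f"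

definition C_k_on :: "nat \<Rightarrow> real set \<Rightarrow> (real \<Rightarrow> real) \<Rightarrow> bool" where
  "C_k_on k S f \<longleftrightarrow>
     (\<forall>j<k. \<forall>x\<in>S. nth_deriv_on S j f differentiable (at x within S)) \<and>
     continuous_on S (nth_deriv_on S k f)"

definition C_inf_on :: "real set \<Rightarrow> (real \<Rightarrow> real) \<Rightarrow> bool" where
  "C_inf_on S f \<longleftrightarrow> (\<forall>k. C_k_on k S f)"

text \<open>
  The Hoelder class \<open>C\<^sup>k\<^sup>,\<^sup>\<gamma>\<close> for \<open>0 \<le> \<gamma> < 1\<close>. For \<open>\<gamma> = 0\<close> on a compact interval the Hoelder bound
  is automatic, because \<open>t powr 0 = 1\<close> for \<open>t > 0\<close>, and the class is plain \<open>C\<^sup>k\<close>.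
\<close>

definition C_Hoelder_on :: "nat \<Rightarrow> real \<Rightarrow> real set \<Rightarrow> (real \<Rightarrow> real) \<Rightarrow> bool" where
  "C_Hoelder_on k \<gamma> S f \<longleftrightarrow>
     C_k_on k S f \<and>
     (\<exists>M. \<forall>x\<in>S. \<forall>y\<in>S. \<bar>nth_deriv_on S k f x - nth_deriv_on S k f y\<bar> \<le> M * \<bar>x - y\<bar> powr \<gamma>)"


section \<open>The Banach space \<open>C\<^sup>1([0,L])\<close> as a metric space\<close>

text \<open>
  Functions on \<open>[0,L]\<close> are represented by extensional functions, so that elements of the space
  that agree on \<open>[0,L]\<close> are equal.
\<close>

definition C1_space :: "real \<Rightarrow> (real \<Rightarrow> real) set" where
  "C1_space L = {f \<in> extensional {0..L}. C_k_on 1 {0..L} f}"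

text \<open>
  The value outside of the space only serves to make the distance total, as required
  by the locale \<open>Metric_space\<close>.
\<close>

definition C1_dist :: "real \<Rightarrow> (real \<Rightarrow> real) \<Rightarrow> (real \<Rightarrow> real) \<Rightarrow> real" where
  "C1_dist L f g =
     (if f \<in> C1_space L \<and> g \<in> C1_space L
      then (SUP x\<in>{0..L}. \<bar>f x - g x\<bar>)
         + (SUP x\<in>{0..L}. \<bar>nth_deriv_on {0..L} 1 f x - nth_deriv_on {0..L} 1 g x\<bar>)
      else 0)"

definition C1_topology :: "real \<Rightarrow> (real \<Rightarrow> real) topology" where
  "C1_topology L = Metric_space.mtopology (C1_space L) (C1_dist L)"

lemma C1_space_continuous:
  assumes "f \<in> C1_space L"
  shows "continuous_on {0..L} f" "continuous_on {0..L} (nth_deriv_on {0..L} 1 f)"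
proof -
  have "f differentiable (at x within {0..L})" if "x \<in> {0..L}" for x
    using assms that by (auto simp: C1_space_def C_k_on_def nth_deriv_on_def)
  then show "continuous_on {0..L} f"
    by (auto simp: continuous_on_eq_continuous_within intro: differentiable_imp_continuous_within)
  show "continuous_on {0..L} (nth_deriv_on {0..L} 1 f)"
    using assms by (simp add: C1_space_def C_k_on_def)
qed

lemma bdd_above_abs_diff:
  fixes f g :: "real \<Rightarrow> real"
  assumes "continuous_on {0..L} f" "continuous_on {0..L} g"
  shows "bdd_above ((\<lambda>x. \<bar>f x - g x\<bar>) ` {0..L})"
proof -
  have "compact ((\<lambda>x. \<bar>f x - g x\<bar>) ` {0..L})"
    by (intro compact_continuous_image continuous_intros assms compact_Icc)
  then show ?thesis
    by (rule bounded_imp_bdd_above[OF compact_imp_bounded])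
qed

lemma SUP_abs_diff_nonneg:
  fixes f g :: "real \<Rightarrow> real"
  assumes "0 < L" "continuous_on {0..L} f" "continuous_on {0..L} g"
  shows "0 \<le> (SUP x\<in>{0..L}. \<bar>f x - g x\<bar>)"
  by (rule cSUP_upper2[OF bdd_above_abs_diff[OF assms(2,3)], of 0]) (use assms in auto)

lemma SUP_abs_diff_triangle:
  fixes f g h :: "real \<Rightarrow> real"
  assumes "0 < L" "continuous_on {0..L} f" "continuous_on {0..L} g" "continuous_on {0..L} h"
  shows "(SUP x\<in>{0..L}. \<bar>f x - h x\<bar>) \<le> (SUP x\<in>{0..L}. \<bar>f x - g x\<bar>) + (SUP x\<in>{0..L}. \<bar>g x - h x\<bar>)"
proof (rule cSUP_least)
  fix x assume x: "x \<in> {0..L}"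
  have "\<bar>f x - g x\<bar> \<le> (SUP x\<in>{0..L}. \<bar>f x - g x\<bar>)"
    using x by (intro cSUP_upper bdd_above_abs_diff assms)
  moreover have "\<bar>g x - h x\<bar> \<le> (SUP x\<in>{0..L}. \<bar>g x - h x\<bar>)"
    using x by (intro cSUP_upper bdd_above_abs_diff assms)
  ultimately show "\<bar>f x - h x\<bar> \<le> (SUP x\<in>{0..L}. \<bar>f x - g x\<bar>) + (SUP x\<in>{0..L}. \<bar>g x - h x\<bar>)"
    by linarith
qed (use assms in auto)

lemma Metric_space_C1:
  assumes L: "0 < L"
  shows "Metric_space (C1_space L) (C1_dist L)"
proof
  note nonneg = SUP_abs_diff_nonneg[OF L]
  fix f g :: "real \<Rightarrow> real"
  show "0 \<le> C1_dist L f g"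
    by (auto simp: C1_dist_def simp del: One_nat_def intro!: add_nonneg_nonneg nonneg C1_space_continuous)
  show "C1_dist L f g = C1_dist L g f"
    by (simp add: C1_dist_def abs_minus_commute)
next
  note nonneg = SUP_abs_diff_nonneg[OF L]
  fix f g assume fg: "f \<in> C1_space L" "g \<in> C1_space L"
  show "C1_dist L f g = 0 \<longleftrightarrow> f = g"
  proof
    assume "C1_dist L f g = 0"
    moreover have "0 \<le> (SUP x\<in>{0..L}. \<bar>f x - g x\<bar>)"
      "0 \<le> (SUP x\<in>{0..L}. \<bar>nth_deriv_on {0..L} 1 f x - nth_deriv_on {0..L} 1 g x\<bar>)"
      using fg by (auto intro!: nonneg C1_space_continuous simp del: One_nat_def)
    ultimately have 0: "(SUP x\<in>{0..L}. \<bar>f x - g x\<bar>) = 0"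
      using fg by (simp add: C1_dist_def)
    have "f x = g x" if "x \<in> {0..L}" for x
      using cSUP_upper[OF that bdd_above_abs_diff[OF C1_space_continuous(1)[OF fg(1)]
            C1_space_continuous(1)[OF fg(2)]]] 0 by simp
    then show "f = g"
      using fg by (intro extensionalityI[of f "{0..L}" g]) (auto simp: C1_space_def)
  next
    assume "f = g"
    then show "C1_dist L f g = 0"
      using L by (simp add: C1_dist_def)
  qed
next
  fix f g h assume "f \<in> C1_space L" "g \<in> C1_space L" "h \<in> C1_space L"
  note fgh = this and cont = this[THEN C1_space_continuous(1)] this[THEN C1_space_continuous(2)]
  show "C1_dist L f h \<le> C1_dist L f g + C1_dist L g h"
    using SUP_abs_diff_triangle[OF L cont(1-3)] SUP_abs_diff_triangle[OF L cont(4-6)] fgh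
    by (simp add: C1_dist_def)
qed


section \<open>The free boundary problem\<close>

definition fbp_solution ::
    "real \<Rightarrow> real \<Rightarrow> real \<Rightarrow> real \<Rightarrow> real \<Rightarrow> (real \<Rightarrow> real) \<Rightarrow> bool" where
  "fbp_solution \<alpha> \<Lambda> v\<^sub>0 c R v \<longleftrightarrow>
     (let \<beta> = 2 * \<alpha> / (1 - \<alpha>);
          v' = nth_deriv_on {0..R} 1 v;
          v'' = nth_deriv_on {0..R} 2 v
      in c > 0 \<and> R > 0 \<and> (\<forall>\<xi>\<in>{0..R}. v \<xi> \<ge> 0) \<and>
         C_inf_on {0..<R} v \<and> C_Hoelder_on (2 + nat \<lfloor>\<beta>\<rfloor>) (frac \<beta>) {0..R} v \<and>
         (\<forall>\<xi>\<in>{0<..<R}. \<Lambda> * v'' \<xi> - c * v' \<xi> = v \<xi> powr \<alpha>) \<and>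
         v 0 = v\<^sub>0 \<and> v' 0 = - (c / \<Lambda>) * (1 - v\<^sub>0) \<and>
         v R = 0 \<and> v' R = 0)"

definition zero_ext :: "real \<Rightarrow> real \<Rightarrow> (real \<Rightarrow> real) \<Rightarrow> real \<Rightarrow> real" where
  "zero_ext L R v = (\<lambda>\<xi>\<in>{0..L}. if \<xi> \<le> R then v \<xi> else 0)"

end

theory Submission
  imports Defs
begin

text \<open>
  Since \<open>v\<close> is strictly decreasing on \<open>[0,R]\<close>, the speed of descent \<open>p = - v'\<close> and the position \<open>X\<close> are
  functions of the level \<open>y = v\<close>. They satisfy \<open>p' = (y\<^sup>\<alpha> / p - c) / \<Lambda>\<close>, \<open>X' = - 1 / p\<close>, \<open>p(0) = 0\<close>,
  so \<open>p\<close> depends on \<open>c\<close> only and is decreasing in \<open>c\<close>, while \<open>c\<close> is determined by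
  \<open>p(v\<^sub>0) = c (1 - v\<^sub>0) / \<Lambda>\<close>. Comparison shows that \<open>p\<close> lies between two multiples of the power
  \<open>(1 + \<alpha>) / 2\<close> of \<open>y\<close>; as \<open>1 / p\<close> is then integrable at \<open>0\<close>, this bounds \<open>R = X(0)\<close>. The same estimates,
  applied to two solutions, show that \<open>c\<close>, \<open>R\<close> and the \<open>C\<^sup>1\<close> extension of \<open>v\<close> are Lipschitz in \<open>v\<^sub>0\<close>.
\<close>

section \<open>The phase plane of a profile\<close>

text \<open>Using levels turns the free endpoint into the fixed level 0, at the price of a
  singularity there: \<open>p 0 = 0\<close>, so both equations degenerate. Hence derivatives are
  assumed only on open intervals, and speeds are compared through p^2, whose equation (p^2)' = 2
  (y^\<alpha> - c p) / \<Lambda> has no division. Its balance without the term c p explains the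
  exponent (1 + \<alpha>) / 2. The constants must not depend on the datum. Dropping c p gives an
  upper bound for p free of c; with the boundary condition it bounds c as long as the datum is at
  most b < 1, and that bound fixes the factor \<mu> of the lower barrier. Strict monotonicity is
  itself an obstacle: a solution is only assumed nonnegative, and v = 0 also satisfies the equation,
  so v might vanish before R. The smoothness on [0,R) excludes this. Finally, orbits are compared at
  equal levels but the C^1 norm at equal positions; Lipschitz bounds for v and v' translate one into
  the other.\<close>

lemma le_if_deriv_nonneg:
  fixes f f' :: "real \<Rightarrow> real"
  assumes "a \<le> b" "continuous_on {a..b} f"
    and "\<And>x. a < x \<Longrightarrow> x < b \<Longrightarrow> (f has_real_derivative f' x) (at x)"
    and "\<And>x. a < x \<Longrightarrow> x < b \<Longrightarrow> 0 \<le> f' x"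
  shows "f a \<le> f b"
proof (rule DERIV_nonneg_imp_increasing_open[OF assms(1) _ assms(2)])
  show "\<exists>d. (f has_real_derivative d) (at x) \<and> 0 \<le> d" if "a < x" "x < b" for x
    using assms(3,4)[OF that] by (intro exI conjI)
qed

lemma compact_vimage_Icc:
  fixes f :: "real \<Rightarrow> real"
  assumes "continuous_on {a..b} f" "closed T"
  shows "compact ({a..b} \<inter> f -` T)"
proof -
  have "closed ({a..b} \<inter> f -` T)"
    by (intro continuous_closed_preimage assms) auto
  then show ?thesis
    by (auto simp: compact_eq_bounded_closed intro: bounded_subset[OF bounded_closed_interval])
qed

text \<open>A comparison principle: the sign of the derivative has to be checked only where the
  claim fails. After the last point z of [0,y] with f z \<ge> 0 the function is negative, hence
  nondecreasing, so f y \<ge> f z.\<close>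

lemma nonneg_if_increasing_where_negative:
  fixes f f' :: "real \<Rightarrow> real"
  assumes cont: "continuous_on {0..V} f" and f0: "0 \<le> f 0"
    and der: "\<And>y. 0 < y \<Longrightarrow> y < V \<Longrightarrow> (f has_real_derivative f' y) (at y)"
    and nonneg: "\<And>y. 0 < y \<Longrightarrow> y < V \<Longrightarrow> f y < 0 \<Longrightarrow> 0 \<le> f' y"
    and y: "0 \<le> y" "y \<le> V"
  shows "0 \<le> f y"
proof (rule ccontr)
  assume neg: "\<not> 0 \<le> f y"
  define A where "A = {0..y} \<inter> f -` {0..}"
  have "compact A"
    unfolding A_def using y by (intro compact_vimage_Icc continuous_on_subset[OF cont]) auto
  moreover have "0 \<in> A"
    using y f0 by (auto simp: A_def)
  ultimately obtain z where z: "z \<in> A" "\<And>t. t \<in> A \<Longrightarrow> t \<le> z"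
    using compact_attains_sup[of A] by blast
  have neg_after: "f t < 0" if "z < t" "t \<le> y" for t
    using z(2)[of t] z(1) that by (force simp: A_def)
  have "f z \<le> f y"
  proof (rule le_if_deriv_nonneg[of z y f f'])
    show "z \<le> y" "continuous_on {z..y} f"
      using z(1) y by (auto simp: A_def intro: continuous_on_subset[OF cont])
    show "(f has_real_derivative f' t) (at t)" "0 \<le> f' t" if "z < t" "t < y" for t
      using der[of t] nonneg[of t] neg_after[of t] that z(1) y by (auto simp: A_def)
  qed
  then show False
    using z(1) neg by (auto simp: A_def)
qed

lemma continuous_on_powr_const:
  fixes r :: real
  assumes "0 < r"
  shows "continuous_on {0..V} (\<lambda>y. y powr r)"
  by (intro continuous_on_powr' continuous_intros) (use assms in auto)

lemma powr_half_power2: "(x powr (r / 2))\<^sup>2 = x powr r" for x r :: real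
  by (simp add: power2_eq_square flip: powr_add)

text \<open>With w = - v' the equation reads w' = (c w - v^\<alpha>) / \<Lambda>, and dp/dy = w' /
  v' gives \<open>der_p\<close>. No value of \<open>X\<close> is fixed, so only differences of
  positions are meaningful here.\<close>

locale phase_orbit =
  fixes \<alpha> \<Lambda> c V :: real and X p :: "real \<Rightarrow> real"
  assumes alpha: "0 < \<alpha>" "\<alpha> < 1" and Lambda: "0 < \<Lambda>" and c: "0 < c" and V: "0 < V" "V \<le> 1"
    and cont_X: "continuous_on {0..V} X" and cont_p: "continuous_on {0..V} p"
    and p_0: "p 0 = 0" and p_pos: "\<And>y. 0 < y \<Longrightarrow> y \<le> V \<Longrightarrow> 0 < p y"
    and der_X: "\<And>y. 0 < y \<Longrightarrow> y < V \<Longrightarrow> (X has_real_derivative - 1 / p y) (at y)"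
    and der_p: "\<And>y. 0 < y \<Longrightarrow> y < V \<Longrightarrow>
      (p has_real_derivative (y powr \<alpha> / p y - c) / \<Lambda>) (at y)"
begin

section \<open>Power bounds for the speed of descent and their consequences for the position\<close>

lemma p_nonneg: "0 \<le> y \<Longrightarrow> y \<le> V \<Longrightarrow> 0 \<le> p y"
  using p_pos[of y] p_0 by (cases "y = 0") auto

lemma der_p_sq:
  assumes "0 < y" "y < V"
  shows "((\<lambda>y. (p y)\<^sup>2) has_real_derivative 2 * (y powr \<alpha> - c * p y) / \<Lambda>) (at y)"
proof (rule DERIV_cong)
  show "((\<lambda>y. (p y)\<^sup>2) has_real_derivative of_nat 2 * ((y powr \<alpha> / p y - c) / \<Lambda> * p y ^ (2 - Suc 0))) (at y)"
    using assms by (intro DERIV_power der_p)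
  show "of_nat 2 * ((y powr \<alpha> / p y - c) / \<Lambda> * p y ^ (2 - Suc 0)) = 2 * (y powr \<alpha> - c * p y) / \<Lambda>"
    using p_pos[of y] assms Lambda by (simp add: field_simps)
qed

text \<open>Without the nonpositive term - c p the equation for p^2 integrates to 2 y^(1 + \<alpha>)
  / (\<Lambda> (1 + \<alpha>)). The constant is therefore the same for all speeds c.\<close>

lemma p_upper:
  assumes "0 \<le> y" "y \<le> V"
  shows "p y \<le> sqrt (2 / (\<Lambda> * (1 + \<alpha>))) * y powr ((1 + \<alpha>) / 2)"
proof -
  define f where "f = (\<lambda>y. 2 / (\<Lambda> * (1 + \<alpha>)) * y powr (1 + \<alpha>) - (p y)\<^sup>2)"
  define f' where "f' = (\<lambda>t. 2 / (\<Lambda> * (1 + \<alpha>)) * ((1 + \<alpha>) * t powr (1 + \<alpha> - 1))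
    - 2 * (t powr \<alpha> - c * p t) / \<Lambda>)"
  have "f 0 \<le> f y"
  proof (rule le_if_deriv_nonneg[of 0 y f f'])
    show "continuous_on {0..y} f"
      unfolding f_def using assms alpha
      by (intro continuous_intros continuous_on_powr_const continuous_on_subset[OF cont_p]) auto
    show "(f has_real_derivative f' t) (at t)" if t: "0 < t" "t < y" for t
      unfolding f_def f'_def using t assms
      by (intro DERIV_diff DERIV_cmult has_real_derivative_powr der_p_sq) auto
    show "0 \<le> f' t" if t: "0 < t" "t < y" for t
    proof -
      have "2 / (\<Lambda> * r) * (r * z) = 2 * z / \<Lambda>" if "r \<noteq> 0" for r z :: real
        using that by simp
      then have "f' t = 2 * c * p t / \<Lambda>"
        using alpha by (simp add: f'_def right_diff_distrib diff_divide_distrib)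
      then show ?thesis
        using p_pos[of t] t assms Lambda c by simp
    qed
  qed (use assms in auto)
  then have "(p y)\<^sup>2 \<le> 2 / (\<Lambda> * (1 + \<alpha>)) * y powr (1 + \<alpha>)"
    using p_0 alpha by (simp add: f_def)
  moreover have "(sqrt (2 / (\<Lambda> * (1 + \<alpha>))))\<^sup>2 = 2 / (\<Lambda> * (1 + \<alpha>))"
    using alpha Lambda by (intro real_sqrt_pow2) (simp add: less_imp_le)
  ultimately have "(p y)\<^sup>2 \<le> (sqrt (2 / (\<Lambda> * (1 + \<alpha>))) * y powr ((1 + \<alpha>) / 2))\<^sup>2"
    by (simp only: power_mult_distrib powr_half_power2)
  then show ?thesis
    by (rule power2_le_imp_le) (use Lambda alpha in simp)
qed

text \<open>The condition on \<mu> makes s = \<mu> y^((1 + \<alpha>) / 2) a lower barrier: where p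
  \<le> s, also c p \<le> c \<mu> y^\<alpha>, so \<Lambda> (p^2)' \<ge> 2 (1 - c \<mu>) y^\<alpha>
  \<ge> 2 \<Lambda> \<mu>^2 y^\<alpha>, which is at least \<Lambda> (s^2)'.\<close>

lemma p_lower:
  assumes mu: "0 \<le> \<mu>" "\<Lambda> * \<mu>\<^sup>2 + c * \<mu> \<le> 1" and y: "0 \<le> y" "y \<le> V"
  shows "\<mu> * y powr ((1 + \<alpha>) / 2) \<le> p y"
proof -
  define f where "f = (\<lambda>y. (p y)\<^sup>2 - \<mu>\<^sup>2 * y powr (1 + \<alpha>))"
  define f' where "f' = (\<lambda>t. 2 * (t powr \<alpha> - c * p t) / \<Lambda> - \<mu>\<^sup>2 * ((1 + \<alpha>) * t powr (1 + \<alpha> - 1)))"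
  define s where "s = (\<lambda>t. \<mu> * t powr ((1 + \<alpha>) / 2))"
  have sq: "f t = (p t)\<^sup>2 - (s t)\<^sup>2" for t
    by (simp only: f_def s_def power_mult_distrib powr_half_power2)
  have "0 \<le> f y"
  proof (rule nonneg_if_increasing_where_negative[of V f f'])
    show "continuous_on {0..V} f"
      unfolding f_def using alpha
      by (intro continuous_intros continuous_on_powr_const cont_p) auto
    show "(f has_real_derivative f' t) (at t)" if t: "0 < t" "t < V" for t
      unfolding f_def f'_def using t
      by (intro DERIV_diff DERIV_cmult has_real_derivative_powr der_p_sq) auto
    show "0 \<le> f' t" if t: "0 < t" "t < V" and "f t < 0" for t
    proof -
      have "(p t)\<^sup>2 < (s t)\<^sup>2"
        using \<open>f t < 0\<close> by (simp add: sq)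
      moreover have "0 \<le> s t"
        using mu(1) by (simp add: s_def)
      ultimately have "p t \<le> s t"
        by (rule less_imp_le[OF power_less_imp_less_base])
      \<comment> \<open>Here t \<le> V \<le> 1 and (1 + \<alpha>) / 2 > \<alpha>, so the barrier
        itself is dominated by the source t^\<alpha>.\<close>
      also have "\<dots> \<le> \<mu> * t powr \<alpha>"
        unfolding s_def using mu(1) t V alpha by (intro mult_left_mono powr_mono') auto
      finally have "c * p t \<le> c * (\<mu> * t powr \<alpha>)"
        using c by simp
      moreover have "(1 + \<alpha>) * (\<Lambda> * \<mu>\<^sup>2 * t powr \<alpha>) \<le> 2 * (\<Lambda> * \<mu>\<^sup>2 * t powr \<alpha>)"
        using alpha Lambda by (intro mult_right_mono) auto
      moreover have "(\<Lambda> * \<mu>\<^sup>2 + c * \<mu>) * t powr \<alpha> \<le> 1 * t powr \<alpha>"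
        using mu(2) by (intro mult_right_mono) auto
      ultimately have "\<Lambda> * (\<mu>\<^sup>2 * ((1 + \<alpha>) * t powr \<alpha>)) \<le> 2 * (t powr \<alpha> - c * p t)"
        by (simp add: algebra_simps)
      then show ?thesis
        using Lambda by (simp add: f'_def field_simps)
    qed
  qed (use p_0 alpha y in \<open>auto simp: f_def\<close>)
  then have "(s y)\<^sup>2 \<le> (p y)\<^sup>2"
    by (simp add: sq)
  then have "s y \<le> p y"
    by (rule power2_le_imp_le[OF _ p_nonneg[OF y]])
  then show ?thesis
    by (simp only: s_def)
qed

text \<open>A weaker bound that is constant on [y,V]; it serves the estimates that stay away from
  level 0.\<close>

lemma p_lower_on:
  assumes mu: "0 < \<mu>" "\<Lambda> * \<mu>\<^sup>2 + c * \<mu> \<le> 1" and y: "0 < y" "y \<le> t" "t \<le> V"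
  shows "\<mu> * y \<le> p t"
proof -
  have "y \<le> t powr 1"
    using y by simp
  also have "\<dots> \<le> t powr ((1 + \<alpha>) / 2)"
    using y V alpha by (intro powr_mono') auto
  finally have "\<mu> * y \<le> \<mu> * t powr ((1 + \<alpha>) / 2)"
    using mu(1) by simp
  also have "\<dots> \<le> p t"
    using mu y by (intro p_lower) auto
  finally show ?thesis .
qed

text \<open>Integrates 1 / p \<le> y^(-(1 + \<alpha>) / 2) / \<mu>, where \<alpha> < 1 keeps the
  exponent above -1. Read at y = V it bounds the width of a wave; read at small y it says that v
  cannot vanish faster than the power 2 / (1 - \<alpha>) of the distance to its zero.\<close>

lemma X_drop:
  assumes mu: "0 < \<mu>" "\<Lambda> * \<mu>\<^sup>2 + c * \<mu> \<le> 1" and y: "0 \<le> y" "y \<le> V"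
  shows "X 0 - X y \<le> y powr ((1 - \<alpha>) / 2) / (\<mu> * ((1 - \<alpha>) / 2))"
proof -
  define k where "k = (1 - \<alpha>) / 2"
  have k: "0 < k" using alpha by (simp add: k_def)
  define f where "f = (\<lambda>y. y powr k / (\<mu> * k) + X y)"
  define f' where "f' = (\<lambda>t. k * t powr (k - 1) / (\<mu> * k) + - 1 / p t)"
  have "f 0 \<le> f y"
  proof (rule le_if_deriv_nonneg[of 0 y f f'])
    show "continuous_on {0..y} f"
      unfolding f_def using y mu k
      by (intro continuous_intros continuous_on_powr_const continuous_on_subset[OF cont_X]) auto
    show "(f has_real_derivative f' t) (at t)" if t: "0 < t" "t < y" for t
      unfolding f_def f'_def using t y
      by (intro DERIV_add DERIV_cdivide has_real_derivative_powr der_X) auto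
    show "0 \<le> f' t" if t: "0 < t" "t < y" for t
    proof -
      have "1 - k = (1 + \<alpha>) / 2"
        by (simp add: k_def field_simps)
      then have "\<mu> * t powr (1 - k) \<le> p t"
        using p_lower[of \<mu> t] t y mu by (metis less_imp_le order.trans)
      then have "1 / p t \<le> 1 / (\<mu> * t powr (1 - k))"
        using mu t y by (intro divide_left_mono mult_pos_pos p_pos) auto
      also have "\<dots> = k * t powr (k - 1) / (\<mu> * k)"
        using k t by (simp add: powr_diff field_simps)
      finally show ?thesis
        by (simp add: f'_def)
    qed
  qed (use y in auto)
  then show ?thesis
    using k by (simp add: f_def flip: k_def)
qed

text \<open>On [y,V] the slope 1 / p lies between 0 and 1 / (\<mu> y). With y the smaller of two
  data, this measures how far the wave with the larger datum \<open>V\<close> travels before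
  reaching that level.\<close>

lemma X_lipschitz:
  assumes mu: "0 < \<mu>" "\<Lambda> * \<mu>\<^sup>2 + c * \<mu> \<le> 1" and y: "0 < y" "y \<le> V"
  shows "0 \<le> X y - X V" "X y - X V \<le> (V - y) / (\<mu> * y)"
proof -
  have cont: "continuous_on {y..V} X"
    using y by (intro continuous_on_subset[OF cont_X]) auto
  have "- X y \<le> - X V"
  proof (rule le_if_deriv_nonneg[of y V "\<lambda>t. - X t" "\<lambda>t. - (- 1 / p t)"])
    show "((\<lambda>t. - X t) has_real_derivative - (- 1 / p t)) (at t)" if "y < t" "t < V" for t
      using that y by (intro DERIV_minus der_X) auto
    show "0 \<le> - (- 1 / p t)" if "y < t" "t < V" for t
      using that y p_pos[of t] by simp
  qed (use y cont in \<open>auto intro: continuous_intros\<close>)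
  then show "0 \<le> X y - X V" by simp
  have "X y + y / (\<mu> * y) \<le> X V + V / (\<mu> * y)"
  proof (rule le_if_deriv_nonneg[of y V "\<lambda>t. X t + t / (\<mu> * y)" "\<lambda>t. - 1 / p t + 1 / (\<mu> * y)"])
    show "continuous_on {y..V} (\<lambda>t. X t + t / (\<mu> * y))"
      using cont mu y by (intro continuous_intros) auto
    show "((\<lambda>t. X t + t / (\<mu> * y)) has_real_derivative - 1 / p t + 1 / (\<mu> * y)) (at t)"
      if "y < t" "t < V" for t
      using that y by (intro DERIV_add DERIV_cdivide DERIV_ident der_X) auto
    show "0 \<le> - 1 / p t + 1 / (\<mu> * y)" if t: "y < t" "t < V" for t
    proof -
      have "1 / p t \<le> 1 / (\<mu> * y)"
        using p_lower_on[OF mu, of y t] mu y t by (intro divide_left_mono mult_pos_pos p_pos) auto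
      then show ?thesis by simp
    qed
  qed (use y in auto)
  then show "X y - X V \<le> (V - y) / (\<mu> * y)"
    by (simp add: diff_divide_distrib)
qed

text \<open>The quantity \<^term>\<open>p y + c * y / \<Lambda>\<close> is the flux of the travelling wave; at \<^term>\<open>V\<close> the boundary
  condition gives it the value \<^term>\<open>c / \<Lambda>\<close>.\<close>

lemma der_flux:
  assumes "0 < y" "y < V"
  shows "((\<lambda>t. p t + c * t / \<Lambda>) has_real_derivative y powr \<alpha> / (\<Lambda> * p y)) (at y)"
proof (rule DERIV_cong)
  show "((\<lambda>t. p t + c * t / \<Lambda>) has_real_derivative (y powr \<alpha> / p y - c) / \<Lambda> + c * 1 / \<Lambda>) (at y)"
    using assms by (intro DERIV_add der_p DERIV_cdivide DERIV_cmult DERIV_ident) auto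
  show "(y powr \<alpha> / p y - c) / \<Lambda> + c * 1 / \<Lambda> = y powr \<alpha> / (\<Lambda> * p y)"
    using Lambda p_pos[of y] assms by (simp add: field_simps)
qed

lemma cont_flux: "continuous_on {0..V} (\<lambda>t. p t + c * t / \<Lambda>)"
  using Lambda by (intro continuous_intros cont_p) auto

lemma flux_mono:
  assumes y: "0 \<le> y" "y \<le> V"
  shows "p y + c * y / \<Lambda> \<le> p V + c * V / \<Lambda>"
proof (rule le_if_deriv_nonneg[of y V "\<lambda>t. p t + c * t / \<Lambda>" "\<lambda>t. t powr \<alpha> / (\<Lambda> * p t)"])
  show "continuous_on {y..V} (\<lambda>t. p t + c * t / \<Lambda>)"
    using y by (intro continuous_on_subset[OF cont_flux]) auto
  show "0 \<le> t powr \<alpha> / (\<Lambda> * p t)" if "y < t" "t < V" for t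
    using that y Lambda p_pos[of t] by simp
qed (use y in \<open>auto intro: der_flux\<close>)

text \<open>The quantitative counterpart of \<open>flux_mono\<close>: t^\<alpha> \<le> 1 and p t
  \<ge> \<mu> y bound the derivative of the flux by 1 / (\<Lambda> \<mu> y).\<close>

lemma flux_increase_le:
  assumes mu: "0 < \<mu>" "\<Lambda> * \<mu>\<^sup>2 + c * \<mu> \<le> 1" and y: "0 < y" "y \<le> V"
  shows "p V + c * V / \<Lambda> \<le> p y + c * y / \<Lambda> + (V - y) / (\<Lambda> * \<mu> * y)"
proof -
  have "y / (\<Lambda> * \<mu> * y) - (p y + c * y / \<Lambda>) \<le> V / (\<Lambda> * \<mu> * y) - (p V + c * V / \<Lambda>)"
  proof (rule le_if_deriv_nonneg[of y V "\<lambda>t. t / (\<Lambda> * \<mu> * y) - (p t + c * t / \<Lambda>)"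
        "\<lambda>t. 1 / (\<Lambda> * \<mu> * y) - t powr \<alpha> / (\<Lambda> * p t)"])
    show "continuous_on {y..V} (\<lambda>t. t / (\<Lambda> * \<mu> * y) - (p t + c * t / \<Lambda>))"
      using Lambda mu y
      by (intro continuous_on_diff continuous_on_subset[OF cont_flux] continuous_intros) auto
    show "((\<lambda>t. t / (\<Lambda> * \<mu> * y) - (p t + c * t / \<Lambda>)) has_real_derivative
        1 / (\<Lambda> * \<mu> * y) - t powr \<alpha> / (\<Lambda> * p t)) (at t)"
      if "y < t" "t < V" for t
      using that y by (intro DERIV_diff der_flux DERIV_cdivide DERIV_ident) auto
    show "0 \<le> 1 / (\<Lambda> * \<mu> * y) - t powr \<alpha> / (\<Lambda> * p t)" if t: "y < t" "t < V" for t
    proof -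
      have "t powr \<alpha> \<le> 1"
        using t y V alpha by (intro powr_le1) auto
      then have "t powr \<alpha> / (\<Lambda> * p t) \<le> 1 / (\<Lambda> * (\<mu> * y))"
        using p_lower_on[OF mu, of y t] mu y t Lambda
        by (intro frac_le mult_left_mono mult_pos_pos) auto
      then show ?thesis by (simp add: mult.assoc)
    qed
  qed (use y in auto)
  then show ?thesis
    by (simp add: diff_divide_distrib)
qed

end

section \<open>Comparison of two orbits\<close>

text \<open>At equal levels the sources cancel: \<Lambda> (p1^2 - p2^2)' = 2 (c2 p2 - c1 p1), which
  is nonnegative wherever p1 < p2.\<close>

lemma phase_speed_antimono:
  assumes orbit1: "phase_orbit \<alpha> \<Lambda> c1 V1 X1 p1" and orbit2: "phase_orbit \<alpha> \<Lambda> c2 V2 X2 p2"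
    and c: "c1 \<le> c2" and y: "0 \<le> y" "y \<le> V1" "y \<le> V2"
  shows "p2 y \<le> p1 y"
proof -
  interpret o1: phase_orbit \<alpha> \<Lambda> c1 V1 X1 p1 by (rule orbit1)
  interpret o2: phase_orbit \<alpha> \<Lambda> c2 V2 X2 p2 by (rule orbit2)
  define f where "f = (\<lambda>y. (p1 y)\<^sup>2 - (p2 y)\<^sup>2)"
  define f' where "f' = (\<lambda>y. 2 * (y powr \<alpha> - c1 * p1 y) / \<Lambda> - 2 * (y powr \<alpha> - c2 * p2 y) / \<Lambda>)"
  have "0 \<le> f y"
  proof (rule nonneg_if_increasing_where_negative[of y f f'])
    show "continuous_on {0..y} f"
      unfolding f_def using y
      by (intro continuous_intros continuous_on_subset[OF o1.cont_p] continuous_on_subset[OF o2.cont_p]) auto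
    show "(f has_real_derivative f' t) (at t)" if "0 < t" "t < y" for t
      unfolding f_def f'_def using that y by (intro DERIV_diff o1.der_p_sq o2.der_p_sq) auto
    show "0 \<le> f' t" if t: "0 < t" "t < y" and "f t < 0" for t
    proof -
      have "(p1 t)\<^sup>2 \<le> (p2 t)\<^sup>2"
        using \<open>f t < 0\<close> by (simp add: f_def)
      then have "p1 t \<le> p2 t"
        by (rule power2_le_imp_le[OF _ o2.p_nonneg]) (use t y in auto)
      then have "c1 * p1 t \<le> c2 * p2 t"
        using c o1.c o1.p_nonneg[of t] t y by (intro mult_mono) auto
      then show ?thesis
        using o1.Lambda by (simp add: f'_def field_simps)
    qed
  qed (use y o1.p_0 o2.p_0 in \<open>auto simp: f_def\<close>)
  then have "(p2 y)\<^sup>2 \<le> (p1 y)\<^sup>2"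
    by (simp add: f_def)
  then show ?thesis
    by (rule power2_le_imp_le[OF _ o1.p_nonneg]) (use y in auto)
qed

text \<open>Since p1 \<ge> p2, the derivative of p1^2 - p2^2 is at most 2 (c2 - c1) p2 / \<Lambda>,
  so by \<open>p_upper\<close> the difference of squares is of order y^(h + 1) with h = (1 +
  \<alpha>) / 2. Dividing by p1 + p2 \<ge> 2 \<mu> y^h leaves a bound linear in y.\<close>

lemma phase_speed_diff:
  assumes orbit1: "phase_orbit \<alpha> \<Lambda> c1 V1 X1 p1" and orbit2: "phase_orbit \<alpha> \<Lambda> c2 V2 X2 p2"
    and c: "c1 \<le> c2" and mu: "0 < \<mu>" "\<Lambda> * \<mu>\<^sup>2 + c2 * \<mu> \<le> 1"
    and y: "0 \<le> y" "y \<le> V1" "y \<le> V2"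
  shows "p1 y - p2 y \<le> (c2 - c1) * sqrt (2 / (\<Lambda> * (1 + \<alpha>))) / (\<Lambda> * \<mu>) * y"
proof (cases "y = 0")
  case False
  interpret o1: phase_orbit \<alpha> \<Lambda> c1 V1 X1 p1 by (rule orbit1)
  interpret o2: phase_orbit \<alpha> \<Lambda> c2 V2 X2 p2 by (rule orbit2)
  define h where "h = (1 + \<alpha>) / 2"
  define K where "K = sqrt (2 / (\<Lambda> * (1 + \<alpha>)))"
  define D where "D = 2 * (c2 - c1) * K / \<Lambda>"
  have h: "0 < h" using o1.alpha by (simp add: h_def)
  have K: "0 \<le> K" using o1.alpha o1.Lambda by (simp add: K_def)
  have D: "0 \<le> D" using K c o1.Lambda by (simp add: D_def)
  define f where "f = (\<lambda>y. D * y powr (h + 1) - ((p1 y)\<^sup>2 - (p2 y)\<^sup>2))"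
  define f' where "f' = (\<lambda>y. D * ((h + 1) * y powr (h + 1 - 1))
    - (2 * (y powr \<alpha> - c1 * p1 y) / \<Lambda> - 2 * (y powr \<alpha> - c2 * p2 y) / \<Lambda>))"
  have mono: "p2 t \<le> p1 t" if "0 \<le> t" "t \<le> y" for t
    using that y by (intro phase_speed_antimono[OF orbit1 orbit2 c]) auto
  have "f 0 \<le> f y"
  proof (rule le_if_deriv_nonneg[of 0 y f f'])
    show "continuous_on {0..y} f"
      unfolding f_def using y h
      by (intro continuous_intros continuous_on_powr_const continuous_on_subset[OF o1.cont_p]
          continuous_on_subset[OF o2.cont_p]) auto
    show "(f has_real_derivative f' t) (at t)" if "0 < t" "t < y" for t
      unfolding f_def f'_def using that y
      by (intro DERIV_diff DERIV_cmult has_real_derivative_powr o1.der_p_sq o2.der_p_sq) auto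
    show "0 \<le> f' t" if t: "0 < t" "t < y" for t
    proof -
      have "c1 * p2 t \<le> c1 * p1 t"
        using mono[of t] t o1.c by simp
      moreover have "(c2 - c1) * p2 t \<le> (c2 - c1) * (K * t powr h)"
        using o2.p_upper[of t] t y c by (intro mult_left_mono) (auto simp: K_def h_def)
      ultimately have "2 * (c2 * p2 t - c1 * p1 t) / \<Lambda> \<le> 2 * ((c2 - c1) * (K * t powr h)) / \<Lambda>"
        using o1.Lambda by (intro divide_right_mono mult_left_mono) (auto simp: algebra_simps)
      also have "\<dots> = D * t powr h"
        by (simp add: D_def)
      \<comment> \<open>The factor h + 1 from differentiating t^(h + 1) is given away, which keeps
        \<open>D\<close> simple.\<close>
      also have "\<dots> \<le> D * ((h + 1) * t powr h)"
        using D h by (intro mult_left_mono) (auto simp: algebra_simps)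
      finally show ?thesis
        by (simp add: f'_def diff_divide_distrib right_diff_distrib)
    qed
  qed (use y in auto)
  then have "(p1 y)\<^sup>2 - (p2 y)\<^sup>2 \<le> D * y powr (h + 1)"
    using h o1.p_0 o2.p_0 by (simp add: f_def)
  also have "\<dots> = D * y * y powr h"
    using y False by (simp add: powr_add)
  finally have le: "(p1 y - p2 y) * (p1 y + p2 y) \<le> D * y * y powr h"
    by (simp add: power2_eq_square algebra_simps)
  have "\<mu> * y powr h \<le> p2 y"
    using o2.p_lower[of \<mu> y] mu y by (simp add: h_def)
  then have "2 * \<mu> * y powr h \<le> p1 y + p2 y"
    using mono[of y] y by simp
  then have "(p1 y - p2 y) * (2 * \<mu> * y powr h) \<le> (p1 y - p2 y) * (p1 y + p2 y)"
    using mono[of y] y by (intro mult_left_mono) auto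
  with le have "((p1 y - p2 y) * (2 * \<mu>)) * y powr h \<le> (D * y) * y powr h"
    by (simp add: algebra_simps)
  then have "(p1 y - p2 y) * (2 * \<mu>) \<le> D * y"
    using y False by (simp add: mult_le_cancel_right)
  then have "p1 y - p2 y \<le> D * y / (2 * \<mu>)"
    using mu by (simp add: pos_le_divide_eq)
  also have "\<dots> = (c2 - c1) * K / (\<Lambda> * \<mu>) * y"
    using mu o1.Lambda by (simp add: D_def field_simps)
  finally show ?thesis by (simp only: K_def)
qed (use orbit1 orbit2 in \<open>simp add: phase_orbit.p_0\<close>)

text \<open>The slopes differ by (p1 - p2) / (p1 p2) \<le> E t / (\<mu>^2 t^(1 + \<alpha>)), that is
  by a multiple of t^(-\<alpha>), which is integrable at 0. The linear factor t of
  \<open>phase_speed_diff\<close> compensates the two vanishing denominators. Subtracting the values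
  at \<open>V1\<close> removes the free additive constants of the positions.\<close>

lemma phase_position_diff:
  assumes orbit1: "phase_orbit \<alpha> \<Lambda> c1 V1 X1 p1" and orbit2: "phase_orbit \<alpha> \<Lambda> c2 V2 X2 p2"
    and c: "c1 \<le> c2" and mu: "0 < \<mu>" "\<Lambda> * \<mu>\<^sup>2 + c2 * \<mu> \<le> 1"
    and y: "0 \<le> y" "y \<le> V1" and V: "V1 \<le> V2"
  shows "\<bar>(X1 y - X2 y) - (X1 V1 - X2 V1)\<bar>
    \<le> (c2 - c1) * sqrt (2 / (\<Lambda> * (1 + \<alpha>))) / (\<Lambda> * \<mu>) / (\<mu>\<^sup>2 * (1 - \<alpha>))"
proof -
  interpret o1: phase_orbit \<alpha> \<Lambda> c1 V1 X1 p1 by (rule orbit1)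
  interpret o2: phase_orbit \<alpha> \<Lambda> c2 V2 X2 p2 by (rule orbit2)
  define E where "E = (c2 - c1) * sqrt (2 / (\<Lambda> * (1 + \<alpha>))) / (\<Lambda> * \<mu>)"
  define G where "G = E / (\<mu>\<^sup>2 * (1 - \<alpha>))"
  have E: "0 \<le> E" using c mu o1.Lambda o1.alpha by (simp add: E_def)
  have G: "0 \<le> G" using E o1.alpha by (simp add: G_def)
  define D where "D = (\<lambda>t. X1 t - X2 t)"
  define D' where "D' = (\<lambda>t. - 1 / p1 t - - 1 / p2 t)"
  have der: "(D has_real_derivative D' t) (at t)" if "y < t" "t < V1" for t
    unfolding D_def D'_def using that y V by (intro DERIV_diff o1.der_X o2.der_X) auto
  have cont: "continuous_on {y..V1} D"
    unfolding D_def using y V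
    by (intro continuous_intros continuous_on_subset[OF o1.cont_X] continuous_on_subset[OF o2.cont_X]) auto
  have mu1: "\<Lambda> * \<mu>\<^sup>2 + c1 * \<mu> \<le> 1"
    using mu mult_right_mono[OF c, of \<mu>] by linarith
  have D'_bounds: "0 \<le> D' t" "D' t \<le> G * ((1 - \<alpha>) * t powr (1 - \<alpha> - 1))" if t: "y < t" "t < V1" for t
  proof -
    have pos: "0 < p1 t" "0 < p2 t"
      using t y V o1.p_pos[of t] o2.p_pos[of t] by auto
    have D'_eq: "D' t = (p1 t - p2 t) / (p1 t * p2 t)"
      using pos by (simp add: D'_def field_simps)
    have mono: "p2 t \<le> p1 t"
      using t y V by (intro phase_speed_antimono[OF orbit1 orbit2 c]) auto
    then show "0 \<le> D' t"
      using pos by (simp add: D'_eq)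
    define s where "s = t powr ((1 + \<alpha>) / 2)"
    have s: "0 < s" "\<mu> * s \<le> p1 t" "\<mu> * s \<le> p2 t"
      using t y V mu mu1 o1.p_lower[of \<mu> t] o2.p_lower[of \<mu> t] by (auto simp: s_def)
    then have "(\<mu> * s) * (\<mu> * s) \<le> p1 t * p2 t"
      using mu pos by (intro mult_mono) auto
    moreover have "(\<mu> * s) * (\<mu> * s) = \<mu>\<^sup>2 * s\<^sup>2"
      by (simp add: power2_eq_square)
    moreover have "s\<^sup>2 = t powr (1 + \<alpha>)"
      by (simp only: s_def powr_half_power2)
    ultimately have "\<mu>\<^sup>2 * t powr (1 + \<alpha>) \<le> p1 t * p2 t"
      by simp
    moreover have "p1 t - p2 t \<le> E * t"
      unfolding E_def using t y V by (intro phase_speed_diff[OF orbit1 orbit2 c mu]) auto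
    ultimately have "D' t \<le> E * t / (\<mu>\<^sup>2 * t powr (1 + \<alpha>))"
      unfolding D'_eq using E mono mu t y by (intro frac_le) auto
    also have "\<dots> = G * ((1 - \<alpha>) * t powr (1 - \<alpha> - 1))"
    proof -
      have "t powr (1 + \<alpha>) = t * t powr \<alpha>" "t powr (1 - \<alpha> - 1) = 1 / t powr \<alpha>"
        using t y by (simp_all add: powr_add powr_minus_divide)
      moreover have "E / (\<mu>\<^sup>2 * r) * (r * z) = E / \<mu>\<^sup>2 * z" if "r \<noteq> 0" for r z
        using that by simp
      ultimately show ?thesis
        using t y o1.alpha by (simp add: G_def)
    qed
    finally show "D' t \<le> G * ((1 - \<alpha>) * t powr (1 - \<alpha> - 1))" .
  qed
  have "D y \<le> D V1"
    by (rule le_if_deriv_nonneg[of y V1 D D', OF _ cont der D'_bounds(1)]) (use y in auto)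
  moreover have "G * y powr (1 - \<alpha>) - D y \<le> G * V1 powr (1 - \<alpha>) - D V1"
  proof (rule le_if_deriv_nonneg[of y V1 "\<lambda>t. G * t powr (1 - \<alpha>) - D t"
        "\<lambda>t. G * ((1 - \<alpha>) * t powr (1 - \<alpha> - 1)) - D' t"])
    show "continuous_on {y..V1} (\<lambda>t. G * t powr (1 - \<alpha>) - D t)"
      using y o1.alpha
      by (intro continuous_intros cont continuous_on_subset[OF continuous_on_powr_const[of _ V1]]) auto
    show "((\<lambda>t. G * t powr (1 - \<alpha>) - D t) has_real_derivative
        G * ((1 - \<alpha>) * t powr (1 - \<alpha> - 1)) - D' t) (at t)" if "y < t" "t < V1" for t
      using that y by (intro DERIV_diff DERIV_cmult has_real_derivative_powr der) auto
    show "0 \<le> G * ((1 - \<alpha>) * t powr (1 - \<alpha> - 1)) - D' t" if "y < t" "t < V1" for t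
      using D'_bounds(2)[OF that] by simp
  qed (use y in auto)
  moreover have "G * V1 powr (1 - \<alpha>) \<le> G * 1"
    using G o1.V o1.alpha by (intro mult_left_mono powr_le1) auto
  moreover have "0 \<le> G * y powr (1 - \<alpha>)"
    using G by simp
  ultimately have "\<bar>D y - D V1\<bar> \<le> G"
    by linarith
  then show ?thesis
    by (simp only: D_def G_def E_def)
qed

text \<open>The flux grows with the level, while \<^term>\<open>p y\<close> decreases in the speed; so a smaller speed at the
  larger datum would violate the boundary condition.\<close>

lemma wave_speed_mono:
  assumes orbit1: "phase_orbit \<alpha> \<Lambda> c1 V1 X1 p1" and orbit2: "phase_orbit \<alpha> \<Lambda> c2 V2 X2 p2"
    and V: "V1 \<le> V2" "V1 < 1"
    and bc: "p1 V1 = c1 * (1 - V1) / \<Lambda>" "p2 V2 = c2 * (1 - V2) / \<Lambda>"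
  shows "c1 \<le> c2"
proof (rule ccontr)
  interpret o1: phase_orbit \<alpha> \<Lambda> c1 V1 X1 p1 by (rule orbit1)
  interpret o2: phase_orbit \<alpha> \<Lambda> c2 V2 X2 p2 by (rule orbit2)
  assume "\<not> c1 \<le> c2"
  then have less: "c2 < c1" by simp
  have "p1 V1 \<le> p2 V1"
    using phase_speed_antimono[OF orbit2 orbit1 less_imp_le[OF less], of V1] V o1.V by auto
  also have "p2 V1 + c2 * V1 / \<Lambda> \<le> c2 / \<Lambda>"
    using o2.flux_mono[of V1] V o1.V by (simp add: bc algebra_simps diff_divide_distrib)
  then have "p2 V1 \<le> c2 * (1 - V1) / \<Lambda>"
    by (simp add: algebra_simps diff_divide_distrib)
  also have "\<dots> < c1 * (1 - V1) / \<Lambda>"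
    using less V o1.Lambda by (intro divide_strict_right_mono mult_strict_right_mono) auto
  finally show False
    by (simp add: bc)
qed

text \<open>The flux of the second orbit is c2 / \<Lambda> at \<open>V2\<close>. At
  \<open>V1\<close> it is at most (c1 (1 - V1) + c2 V1) / \<Lambda>, because p2 \<le> p1 there, and
  its growth in between is controlled by \<open>flux_increase_le\<close>. Solving for c2 - c1
  divides by 1 - V1, hence the role of b < 1.\<close>

lemma wave_speed_diff:
  assumes orbit1: "phase_orbit \<alpha> \<Lambda> c1 V1 X1 p1" and orbit2: "phase_orbit \<alpha> \<Lambda> c2 V2 X2 p2"
    and V: "V1 \<le> V2" "V1 < 1"
    and bc: "p1 V1 = c1 * (1 - V1) / \<Lambda>" "p2 V2 = c2 * (1 - V2) / \<Lambda>"
    and mu: "0 < \<mu>" "\<Lambda> * \<mu>\<^sup>2 + c2 * \<mu> \<le> 1"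
  shows "c2 - c1 \<le> (V2 - V1) / (\<mu> * V1 * (1 - V1))"
proof -
  interpret o1: phase_orbit \<alpha> \<Lambda> c1 V1 X1 p1 by (rule orbit1)
  interpret o2: phase_orbit \<alpha> \<Lambda> c2 V2 X2 p2 by (rule orbit2)
  have "p2 V1 \<le> c1 * (1 - V1) / \<Lambda>"
    using phase_speed_antimono[OF orbit1 orbit2 wave_speed_mono[OF orbit1 orbit2 V bc], of V1]
      V o1.V by (simp add: bc)
  moreover have "p2 V2 + c2 * V2 / \<Lambda> \<le> p2 V1 + c2 * V1 / \<Lambda> + (V2 - V1) / (\<Lambda> * \<mu> * V1)"
    using o2.flux_increase_le[OF mu, of V1] V o1.V by simp
  moreover have "p2 V2 + c2 * V2 / \<Lambda> = c2 / \<Lambda>"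
    using o1.Lambda by (simp add: bc field_simps)
  moreover have "(V2 - V1) / (\<Lambda> * \<mu> * V1) = (V2 - V1) / (\<mu> * V1) / \<Lambda>"
    by (simp add: mult.commute mult.left_commute)
  ultimately have "c2 / \<Lambda> \<le> (c1 * (1 - V1) + c2 * V1 + (V2 - V1) / (\<mu> * V1)) / \<Lambda>"
    unfolding add_divide_distrib by linarith
  then have "c2 \<le> c1 * (1 - V1) + c2 * V1 + (V2 - V1) / (\<mu> * V1)"
    using o1.Lambda by (simp add: divide_le_cancel)
  then have "(c2 - c1) * (1 - V1) \<le> (V2 - V1) / (\<mu> * V1)"
    by (simp add: algebra_simps)
  then show ?thesis
    using V by (simp add: pos_le_divide_eq mult.assoc flip: divide_divide_eq_left)
qed

section \<open>Wave profiles\<close>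

lemma lipschitz_if_deriv_bounded:
  fixes f f' :: "real \<Rightarrow> real"
  assumes cont: "continuous_on {a..b} f"
    and der: "\<And>x. a < x \<Longrightarrow> x < b \<Longrightarrow> (f has_real_derivative f' x) (at x)"
    and bound: "\<And>x. a < x \<Longrightarrow> x < b \<Longrightarrow> \<bar>f' x\<bar> \<le> B"
    and "x \<in> {a..b}" "y \<in> {a..b}"
  shows "\<bar>f x - f y\<bar> \<le> B * \<bar>x - y\<bar>"
proof -
  have *: "\<bar>f y - f x\<bar> \<le> B * (y - x)" if "a \<le> x" "x \<le> y" "y \<le> b" for x y
  proof -
    have cont': "continuous_on {x..y} f"
      using that by (intro continuous_on_subset[OF cont]) auto
    have "B * x - f x \<le> B * y - f y"
    proof (rule le_if_deriv_nonneg[of x y "\<lambda>t. B * t - f t" "\<lambda>t. B * 1 - f' t"])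
      show "((\<lambda>t. B * t - f t) has_real_derivative B * 1 - f' t) (at t)" if "x < t" "t < y" for t
        using that \<open>a \<le> x\<close> \<open>y \<le> b\<close> by (intro DERIV_diff DERIV_cmult DERIV_ident der) auto
      show "0 \<le> B * 1 - f' t" if "x < t" "t < y" for t
        using that \<open>a \<le> x\<close> \<open>y \<le> b\<close> bound[of t] by auto
    qed (use that cont' in \<open>auto intro!: continuous_intros\<close>)
    moreover have "B * x + f x \<le> B * y + f y"
    proof (rule le_if_deriv_nonneg[of x y "\<lambda>t. B * t + f t" "\<lambda>t. B * 1 + f' t"])
      show "((\<lambda>t. B * t + f t) has_real_derivative B * 1 + f' t) (at t)" if "x < t" "t < y" for t
        using that \<open>a \<le> x\<close> \<open>y \<le> b\<close> by (intro DERIV_add DERIV_cmult DERIV_ident der) auto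
      show "0 \<le> B * 1 + f' t" if "x < t" "t < y" for t
        using that \<open>a \<le> x\<close> \<open>y \<le> b\<close> bound[of t] by auto
    qed (use that cont' in \<open>auto intro!: continuous_intros\<close>)
    ultimately show ?thesis
      by (simp add: abs_le_iff right_diff_distrib)
  qed
  show ?thesis
    using *[of x y] *[of y x] assms(4,5) by (cases "x \<le> y") (auto simp: abs_minus_commute)
qed

text \<open>Here \<open>w\<close> stands for - v'. The endpoint \<open>\<rho>\<close> is kept
  separate from R so that the locale also covers a solution cut off at a hypothetical earlier
  zero.\<close>

locale wave_profile =
  fixes \<alpha> \<Lambda> c \<rho> :: real and v w :: "real \<Rightarrow> real"
  assumes alpha: "0 < \<alpha>" "\<alpha> < 1" and Lambda: "0 < \<Lambda>" and c: "0 < c" and rho: "0 < \<rho>"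
    and v_0: "v 0 \<le> 1" and v_pos: "\<And>x. 0 \<le> x \<Longrightarrow> x < \<rho> \<Longrightarrow> 0 < v x"
    and v_end: "v \<rho> = 0" and w_end: "w \<rho> = 0"
    and cont_v: "continuous_on {0..\<rho>} v" and cont_w: "continuous_on {0..\<rho>} w"
    and der_v: "\<And>x. 0 < x \<Longrightarrow> x < \<rho> \<Longrightarrow> (v has_real_derivative - w x) (at x)"
    and der_w: "\<And>x. 0 < x \<Longrightarrow> x < \<rho> \<Longrightarrow> (w has_real_derivative (c * w x - v x powr \<alpha>) / \<Lambda>) (at x)"
begin

text \<open>The integrating factor exp (- c x / \<Lambda>) removes the term c w, leaving a strictly
  decreasing product that vanishes at \<rho>.\<close>

lemma w_pos:
  assumes "0 \<le> x" "x < \<rho>"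
  shows "0 < w x"
proof -
  define g where "g = (\<lambda>x. exp (- (c / \<Lambda>) * x) * w x)"
  have "g \<rho> < g x"
  proof (rule DERIV_neg_imp_decreasing_open[of x \<rho> g])
    show "continuous_on {x..\<rho>} g"
      unfolding g_def using assms
      by (intro continuous_intros continuous_on_subset[OF cont_w]) auto
    show "\<exists>d. (g has_real_derivative d) (at t) \<and> d < 0" if t: "x < t" "t < \<rho>" for t
    proof (intro exI conjI)
      have "((\<lambda>x. exp (- (c / \<Lambda>) * x)) has_real_derivative exp (- (c / \<Lambda>) * t) * (- (c / \<Lambda>) * 1)) (at t)"
        by (intro DERIV_fun_exp DERIV_cmult DERIV_ident)
      then show "(g has_real_derivative
          exp (- (c / \<Lambda>) * t) * (- (c / \<Lambda>) * 1) * w t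
          + (c * w t - v t powr \<alpha>) / \<Lambda> * exp (- (c / \<Lambda>) * t)) (at t)"
        unfolding g_def using t assms by (intro DERIV_mult der_w) auto
      have "exp (- (c / \<Lambda>) * t) * (- (c / \<Lambda>) * 1) * w t + (c * w t - v t powr \<alpha>) / \<Lambda> * exp (- (c / \<Lambda>) * t)
          = - (exp (- (c / \<Lambda>) * t) * v t powr \<alpha> / \<Lambda>)"
        by (simp add: diff_divide_distrib algebra_simps)
      also have "\<dots> < 0"
        using v_pos[of t] t assms Lambda by simp
      finally show "exp (- (c / \<Lambda>) * t) * (- (c / \<Lambda>) * 1) * w t
          + (c * w t - v t powr \<alpha>) / \<Lambda> * exp (- (c / \<Lambda>) * t) < 0" .
    qed
  qed (use assms in auto)
  then show ?thesis
    by (simp add: g_def w_end zero_less_mult_iff)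
qed

lemma w_nonneg: "0 \<le> x \<Longrightarrow> x \<le> \<rho> \<Longrightarrow> 0 \<le> w x"
  using w_pos[of x] w_end by (cases "x = \<rho>") auto

lemma v_strict_antimono:
  assumes "0 \<le> x" "x < y" "y \<le> \<rho>"
  shows "v y < v x"
proof (rule DERIV_neg_imp_decreasing_open[of x y v])
  show "continuous_on {x..y} v"
    using assms by (intro continuous_on_subset[OF cont_v]) auto
  show "\<exists>d. (v has_real_derivative d) (at t) \<and> d < 0" if "x < t" "t < y" for t
    using that assms w_pos[of t] by (intro exI[of _ "- w t"] conjI der_v) auto
qed (use assms in auto)

lemma v_range:
  assumes "0 \<le> x" "x \<le> \<rho>"
  shows "0 \<le> v x" "v x \<le> v 0"
proof -
  show "0 \<le> v x"
    using v_pos[of x] v_end assms by (cases "x = \<rho>") auto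
  show "v x \<le> v 0"
    using v_strict_antimono[of 0 x] assms by (cases "x = 0") auto
qed

lemma inj_on_v: "inj_on v {0..\<rho>}"
proof (rule inj_onI)
  fix x y assume "x \<in> {0..\<rho>}" "y \<in> {0..\<rho>}" "v x = v y"
  then show "x = y"
    using v_strict_antimono[of x y] v_strict_antimono[of y x] by (cases x y rule: linorder_cases) auto
qed

lemma image_v: "v ` {0..\<rho>} = {0..v 0}"
proof
  show "v ` {0..\<rho>} \<subseteq> {0..v 0}"
    using v_range by auto
  show "{0..v 0} \<subseteq> v ` {0..\<rho>}"
  proof
    fix y assume "y \<in> {0..v 0}"
    then have "\<exists>x\<ge>0. x \<le> \<rho> \<and> v x = y"
      using IVT2'[of v \<rho> y 0] cont_v rho v_end by auto
    then show "y \<in> v ` {0..\<rho>}" by auto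
  qed
qed

section \<open>Inversion of a profile: the level as independent variable\<close>

definition position :: "real \<Rightarrow> real" where
  "position = the_inv_into {0..\<rho>} v"

definition speed :: "real \<Rightarrow> real" where
  "speed y = w (position y)"

lemma position_v: "x \<in> {0..\<rho>} \<Longrightarrow> position (v x) = x"
  by (simp add: position_def the_inv_into_f_f[OF inj_on_v])

lemma position_range: "y \<in> {0..v 0} \<Longrightarrow> position y \<in> {0..\<rho>}"
  unfolding position_def by (intro the_inv_into_into[OF inj_on_v]) (auto simp: image_v)

lemma v_position: "y \<in> {0..v 0} \<Longrightarrow> v (position y) = y"
  unfolding position_def by (intro f_the_inv_into_f[OF inj_on_v]) (auto simp: image_v)

lemma position_interior:
  assumes "0 < y" "y < v 0"
  shows "0 < position y" "position y < \<rho>"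
  using position_range[of y] v_position[of y] assms v_end
  by (auto simp: less_le)

lemma cont_position: "continuous_on {0..v 0} position"
  using continuous_on_inv[OF cont_v compact_Icc, of position] position_v by (simp add: image_v)

lemma der_position:
  assumes y: "0 < y" "y < v 0"
  shows "(position has_real_derivative - 1 / speed y) (at y)"
proof -
  have "(position has_real_derivative inverse (- w (position y))) (at y)"
  proof (rule DERIV_inverse_function)
    show "(v has_real_derivative - w (position y)) (at (position y))"
      using position_interior[OF y] by (intro der_v)
    show "- w (position y) \<noteq> 0"
      using w_pos[of "position y"] position_interior[OF y] by simp
    show "v (position z) = z" if "0 < z" "z < v 0" for z
      using that by (intro v_position) auto
    show "isCont position y"
      using y by (intro continuous_on_interior[OF cont_position]) auto
  qed (use y in auto)
  then show ?thesis
    by (simp add: speed_def divide_inverse)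
qed

lemma phase_orbit_profile: "phase_orbit \<alpha> \<Lambda> c (v 0) position speed"
proof
  show "0 < \<alpha>" "\<alpha> < 1" "0 < \<Lambda>" "0 < c" "v 0 \<le> 1"
    using alpha Lambda c v_0 by auto
  show "0 < v 0"
    using v_pos[of 0] rho by auto
  show "continuous_on {0..v 0} position"
    by (rule cont_position)
  show "continuous_on {0..v 0} speed"
    unfolding speed_def
    by (intro continuous_on_compose2[OF cont_w cont_position]) (use position_range in auto)
  have "position 0 = \<rho>"
    using position_v[of \<rho>] v_end rho by auto
  then show "speed 0 = 0"
    by (simp add: speed_def w_end)
  show "0 < speed y" if "0 < y" "y \<le> v 0" for y
  proof -
    have "position y \<noteq> \<rho>"
      using v_position[of y] v_end that by auto
    then show ?thesis
      unfolding speed_def using position_range[of y] that by (intro w_pos) auto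
  qed
  show "(position has_real_derivative - 1 / speed y) (at y)" if "0 < y" "y < v 0" for y
    using that by (rule der_position)
  show "(speed has_real_derivative (y powr \<alpha> / speed y - c) / \<Lambda>) (at y)" if y: "0 < y" "y < v 0" for y
  proof (rule DERIV_cong)
    show "(speed has_real_derivative (c * w (position y) - v (position y) powr \<alpha>) / \<Lambda> * (- 1 / speed y)) (at y)"
      unfolding speed_def[abs_def]
      using position_interior[OF y] der_position[OF y]
      by (intro DERIV_chain2[of w] der_w) (auto simp: speed_def)
    show "(c * w (position y) - v (position y) powr \<alpha>) / \<Lambda> * (- 1 / speed y)
        = (y powr \<alpha> / speed y - c) / \<Lambda>"
      using w_pos[of "position y"] position_interior[OF y] v_position[of y] y Lambda
      by (simp add: speed_def field_simps)
  qed
qed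

lemma position_0: "position 0 = \<rho>"
  using position_v[of \<rho>] v_end rho by auto

lemma position_v_0: "position (v 0) = 0"
  using position_v[of 0] rho by auto

lemma speed_v: "x \<in> {0..\<rho>} \<Longrightarrow> speed (v x) = w x"
  by (simp add: speed_def position_v)

lemma w_le:
  assumes "0 \<le> x" "x \<le> \<rho>"
  shows "w x \<le> sqrt (2 / (\<Lambda> * (1 + \<alpha>)))"
proof -
  interpret phase_orbit \<alpha> \<Lambda> c "v 0" position speed by (rule phase_orbit_profile)
  have "w x \<le> sqrt (2 / (\<Lambda> * (1 + \<alpha>))) * v x powr ((1 + \<alpha>) / 2)"
    using p_upper[of "v x"] v_range[of x] speed_v[of x] assms by simp
  also have "\<dots> \<le> sqrt (2 / (\<Lambda> * (1 + \<alpha>))) * 1"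
    using v_range[of x] assms V alpha Lambda by (intro mult_left_mono powr_le1) auto
  finally show ?thesis by simp
qed

lemma v_lipschitz:
  assumes "x \<in> {0..\<rho>}" "y \<in> {0..\<rho>}"
  shows "\<bar>v x - v y\<bar> \<le> sqrt (2 / (\<Lambda> * (1 + \<alpha>))) * \<bar>x - y\<bar>"
  by (rule lipschitz_if_deriv_bounded[OF cont_v der_v]) (use assms w_le w_nonneg in auto)

lemma w_lipschitz:
  assumes "x \<in> {0..\<rho>}" "y \<in> {0..\<rho>}"
  shows "\<bar>w x - w y\<bar> \<le> (c * sqrt (2 / (\<Lambda> * (1 + \<alpha>))) + 1) / \<Lambda> * \<bar>x - y\<bar>"
proof (rule lipschitz_if_deriv_bounded[OF cont_w der_w])
  show "\<bar>(c * w t - v t powr \<alpha>) / \<Lambda>\<bar> \<le> (c * sqrt (2 / (\<Lambda> * (1 + \<alpha>))) + 1) / \<Lambda>" if t: "0 < t" "t < \<rho>" for t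
  proof -
    have "\<bar>c * w t\<bar> \<le> c * sqrt (2 / (\<Lambda> * (1 + \<alpha>)))"
      using c w_le[of t] w_nonneg[of t] t by (simp add: abs_mult)
    moreover have "\<bar>v t powr \<alpha>\<bar> \<le> 1"
      using v_range[of t] t v_0 alpha by (auto intro!: powr_le1)
    ultimately have "\<bar>c * w t - v t powr \<alpha>\<bar> \<le> c * sqrt (2 / (\<Lambda> * (1 + \<alpha>))) + 1"
      by linarith
    then show ?thesis
      using Lambda by (simp add: divide_right_mono)
  qed
qed (use assms in auto)

lemma width_le:
  assumes mu: "0 < \<mu>" "\<Lambda> * \<mu>\<^sup>2 + c * \<mu> \<le> 1"
  shows "\<rho> \<le> 1 / (\<mu> * ((1 - \<alpha>) / 2))"
proof -
  interpret phase_orbit \<alpha> \<Lambda> c "v 0" position speed by (rule phase_orbit_profile)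
  have "\<rho> \<le> v 0 powr ((1 - \<alpha>) / 2) / (\<mu> * ((1 - \<alpha>) / 2))"
    using X_drop[OF mu, of "v 0"] V position_0 position_v_0 by simp
  also have "\<dots> \<le> 1 / (\<mu> * ((1 - \<alpha>) / 2))"
    using V alpha mu by (intro divide_right_mono powr_le1) auto
  finally show ?thesis .
qed

end

section \<open>From comparison at equal levels to comparison at equal positions\<close>

text \<open>Because f \<rho> = 0, extension by zero amounts to composing f with x \<mapsto> min x
  \<rho>, which is 1-Lipschitz.\<close>

lemma abs_extension_diff_le:
  fixes f :: "real \<Rightarrow> real"
  assumes lip: "\<And>x y. x \<in> {0..\<rho>} \<Longrightarrow> y \<in> {0..\<rho>} \<Longrightarrow> \<bar>f x - f y\<bar> \<le> B * \<bar>x - y\<bar>"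
    and "f \<rho> = 0" "0 \<le> \<rho>" "0 \<le> B" and x: "0 \<le> x" and y: "0 \<le> y"
  shows "\<bar>(if x \<le> \<rho> then f x else 0) - (if y \<le> \<rho> then f y else 0)\<bar> \<le> B * \<bar>x - y\<bar>"
proof -
  have *: "(if x \<le> \<rho> then f x else 0) = f (min x \<rho>)" for x
    using \<open>f \<rho> = 0\<close> by (simp add: min_def)
  have "\<bar>f (min x \<rho>) - f (min y \<rho>)\<bar> \<le> B * \<bar>min x \<rho> - min y \<rho>\<bar>"
    using assms by (intro lip) auto
  also have "\<dots> \<le> B * \<bar>x - y\<bar>"
    using \<open>0 \<le> B\<close> by (intro mult_left_mono) auto
  finally show ?thesis
    unfolding * .
qed

text \<open>\<open>M\<^sub>c\<close> and \<open>M\<^sub>X\<close> are Lipschitz constants for the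
  speed and for the position of a level. In \<open>M\<^sub>X\<close> the first summand stems from
  the different speeds, the second from the different starting levels.\<close>

lemma wave_profile_compare:
  fixes \<alpha> \<Lambda> a b C \<mu> :: real
  defines "K \<equiv> sqrt (2 / (\<Lambda> * (1 + \<alpha>)))"
  defines "M\<^sub>c \<equiv> 1 / (\<mu> * a * (1 - b))"
  defines "M\<^sub>X \<equiv> M\<^sub>c * K / (\<Lambda> * \<mu>) / (\<mu>\<^sup>2 * (1 - \<alpha>)) + 1 / (\<mu> * a)"
  assumes profile1: "wave_profile \<alpha> \<Lambda> c1 \<rho>1 v1 w1" and profile2: "wave_profile \<alpha> \<Lambda> c2 \<rho>2 v2 w2"
    and bc: "w1 0 = c1 * (1 - v1 0) / \<Lambda>" "w2 0 = c2 * (1 - v2 0) / \<Lambda>"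
    and range: "0 < a" "a \<le> v1 0" "v1 0 \<le> v2 0" "v2 0 \<le> b" "b < 1"
    and mu: "0 < \<mu>" "\<Lambda> * \<mu>\<^sup>2 + C * \<mu> \<le> 1" and C: "c2 \<le> C"
  shows "\<bar>c1 - c2\<bar> \<le> M\<^sub>c * \<bar>v1 0 - v2 0\<bar>"
    and "\<bar>\<rho>1 - \<rho>2\<bar> \<le> M\<^sub>X * \<bar>v1 0 - v2 0\<bar>"
    and "0 \<le> x \<Longrightarrow> \<bar>(if x \<le> \<rho>1 then v1 x else 0) - (if x \<le> \<rho>2 then v2 x else 0)\<bar>
      \<le> K * M\<^sub>X * \<bar>v1 0 - v2 0\<bar>"
    and "0 \<le> x \<Longrightarrow> \<bar>(if x \<le> \<rho>1 then w1 x else 0) - (if x \<le> \<rho>2 then w2 x else 0)\<bar>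
      \<le> (M\<^sub>c * K / (\<Lambda> * \<mu>) + (C * K + 1) / \<Lambda> * M\<^sub>X) * \<bar>v1 0 - v2 0\<bar>"
proof -
  interpret w1: wave_profile \<alpha> \<Lambda> c1 \<rho>1 v1 w1 by (rule profile1)
  interpret w2: wave_profile \<alpha> \<Lambda> c2 \<rho>2 v2 w2 by (rule profile2)
  note orbit1 = w1.phase_orbit_profile and orbit2 = w2.phase_orbit_profile
  interpret o1: phase_orbit \<alpha> \<Lambda> c1 "v1 0" w1.position w1.speed by (rule orbit1)
  interpret o2: phase_orbit \<alpha> \<Lambda> c2 "v2 0" w2.position w2.speed by (rule orbit2)
  define d where "d = \<bar>v1 0 - v2 0\<bar>"
  have d: "d = v2 0 - v1 0" "0 \<le> d" using range by (auto simp: d_def)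
  have mu2: "\<Lambda> * \<mu>\<^sup>2 + c2 * \<mu> \<le> 1"
    using mu mult_right_mono[OF C, of \<mu>] by linarith
  have K: "0 \<le> K" using o1.alpha o1.Lambda by (simp add: K_def)
  have Mc: "0 \<le> M\<^sub>c" using range mu by (simp add: M\<^sub>c_def)
  have MX: "0 \<le> M\<^sub>X" using Mc K range mu o1.alpha o1.Lambda by (simp add: M\<^sub>X_def)
  have L: "0 \<le> (C * K + 1) / \<Lambda>" using K C o2.c o1.Lambda by simp
  have less1: "v1 0 < 1" using range by simp
  have speed_bc: "w1.speed (v1 0) = c1 * (1 - v1 0) / \<Lambda>" "w2.speed (v2 0) = c2 * (1 - v2 0) / \<Lambda>"
    using w1.speed_v[of 0] w2.speed_v[of 0] bc w1.rho w2.rho by auto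
  note c_mono = wave_speed_mono[OF orbit1 orbit2 range(3) less1 speed_bc]
  have "c2 - c1 \<le> d / (\<mu> * v1 0 * (1 - v1 0))"
    using wave_speed_diff[OF orbit1 orbit2 range(3) less1 speed_bc mu(1) mu2] by (simp add: d)
  also have "\<dots> \<le> d / (\<mu> * a * (1 - b))"
    using range mu d by (intro divide_left_mono mult_mono mult_pos_pos) auto
  finally have c_diff: "c2 - c1 \<le> M\<^sub>c * d"
    by (simp add: M\<^sub>c_def)
  then show "\<bar>c1 - c2\<bar> \<le> M\<^sub>c * \<bar>v1 0 - v2 0\<bar>"
    using c_mono by (simp add: d_def)
  have X_diff: "\<bar>w1.position y - w2.position y\<bar> \<le> M\<^sub>X * d" if y: "0 \<le> y" "y \<le> v1 0" for y
  proof -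
    have "\<bar>(w1.position y - w2.position y) - (w1.position (v1 0) - w2.position (v1 0))\<bar>
        \<le> (c2 - c1) * K / (\<Lambda> * \<mu>) / (\<mu>\<^sup>2 * (1 - \<alpha>))"
      unfolding K_def by (rule phase_position_diff[OF orbit1 orbit2 c_mono mu(1) mu2 y range(3)])
    also have "\<dots> \<le> (M\<^sub>c * d) * K / (\<Lambda> * \<mu>) / (\<mu>\<^sup>2 * (1 - \<alpha>))"
      using c_diff K mu o1.Lambda o1.alpha by (intro divide_right_mono mult_right_mono) auto
    finally have 1: "\<bar>(w1.position y - w2.position y) - (w1.position (v1 0) - w2.position (v1 0))\<bar>
        \<le> (M\<^sub>c * d) * K / (\<Lambda> * \<mu>) / (\<mu>\<^sup>2 * (1 - \<alpha>))" .
    \<comment> \<open>The first wave starts at level v1 0, whereas the second one has to descend to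
      it from v2 0.\<close>
    have "0 \<le> w2.position (v1 0)" "w2.position (v1 0) \<le> d / (\<mu> * v1 0)"
      using o2.X_lipschitz[OF mu(1) mu2, of "v1 0"] range w2.position_v_0 by (auto simp: d)
    moreover have "d / (\<mu> * v1 0) \<le> d / (\<mu> * a)"
      using range mu d by (intro divide_left_mono mult_mono mult_pos_pos) auto
    ultimately have 2: "\<bar>w1.position (v1 0) - w2.position (v1 0)\<bar> \<le> d / (\<mu> * a)"
      using w1.position_v_0 by simp
    have "M\<^sub>X * d = (M\<^sub>c * d) * K / (\<Lambda> * \<mu>) / (\<mu>\<^sup>2 * (1 - \<alpha>)) + d / (\<mu> * a)"
      by (simp add: M\<^sub>X_def algebra_simps)
    with 1 2 show ?thesis by linarith
  qed
  have "\<bar>\<rho>1 - \<rho>2\<bar> \<le> M\<^sub>X * d"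
    using X_diff[of 0] range w1.position_0 w2.position_0 by simp
  then show "\<bar>\<rho>1 - \<rho>2\<bar> \<le> M\<^sub>X * \<bar>v1 0 - v2 0\<bar>" by (simp add: d_def)
  note rho_diff = \<open>\<bar>\<rho>1 - \<rho>2\<bar> \<le> M\<^sub>X * d\<close>
  \<comment> \<open>With y = v1 x, the detour through the point where the second wave has level y
    splits the difference: \<open>e\<close> is the error at equal levels, and the shift of position
    costs at most B M_X d. It is applied both to the profiles and to their slopes.\<close>
  have compare: "\<bar>(if x \<le> \<rho>1 then f1 x else 0) - (if x \<le> \<rho>2 then f2 x else 0)\<bar> \<le> e + B * (M\<^sub>X * d)"
    if lip: "\<And>x y. x \<in> {0..\<rho>2} \<Longrightarrow> y \<in> {0..\<rho>2} \<Longrightarrow> \<bar>f2 x - f2 y\<bar> \<le> B * \<bar>x - y\<bar>"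
      and "f2 \<rho>2 = 0" "0 \<le> B" "0 \<le> e" and x: "0 \<le> x"
      and level: "\<And>y. 0 \<le> y \<Longrightarrow> y \<le> v1 0 \<Longrightarrow> \<bar>f1 (w1.position y) - f2 (w2.position y)\<bar> \<le> e"
    for f1 f2 B e x
  proof -
    define g where "g = (\<lambda>x. if x \<le> \<rho>2 then f2 x else 0)"
    have g_lip: "\<bar>g x - g y\<bar> \<le> B * \<bar>x - y\<bar>" if "0 \<le> x" "0 \<le> y" for x y
      unfolding g_def using that w2.rho \<open>f2 \<rho>2 = 0\<close> \<open>0 \<le> B\<close> lip by (intro abs_extension_diff_le) auto
    show ?thesis
    proof (cases "x \<le> \<rho>1")
      case True
      define y where "y = v1 x"
      have y: "0 \<le> y" "y \<le> v1 0" and X1: "w1.position y = x"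
        using w1.v_range[of x] w1.position_v[of x] x True by (auto simp: y_def)
      have X2: "w2.position y \<in> {0..\<rho>2}"
        using y range by (intro w2.position_range) auto
      then have "\<bar>f1 x - g (w2.position y)\<bar> \<le> e"
        using level[OF y] by (simp add: g_def X1)
      moreover have "\<bar>g (w2.position y) - g x\<bar> \<le> B * (M\<^sub>X * d)"
      proof -
        have "\<bar>g (w2.position y) - g x\<bar> \<le> B * \<bar>w2.position y - x\<bar>"
          using X2 x by (intro g_lip) auto
        also have "\<dots> \<le> B * (M\<^sub>X * d)"
          using X_diff[OF y] \<open>0 \<le> B\<close> by (intro mult_left_mono) (auto simp: X1 abs_minus_commute)
        finally show ?thesis .
      qed
      ultimately have "\<bar>f1 x - g x\<bar> \<le> e + B * (M\<^sub>X * d)"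
        by linarith
      then show ?thesis
        using True by (simp add: g_def)
    next
      \<comment> \<open>Beyond \<rho>1 the first extension is 0, and so is the second one at
        \<rho>2; a point between them is within |\<rho>1 - \<rho>2| of \<rho>2.\<close>
      case False
      have "\<bar>g x\<bar> \<le> B * (M\<^sub>X * d)"
      proof (cases "x \<le> \<rho>2")
        case True
        have "\<bar>g x - g \<rho>2\<bar> \<le> B * \<bar>x - \<rho>2\<bar>"
          using x w2.rho by (intro g_lip) auto
        also have "\<dots> \<le> B * (M\<^sub>X * d)"
          using rho_diff \<open>\<not> x \<le> \<rho>1\<close> True \<open>0 \<le> B\<close> by (intro mult_left_mono) auto
        finally show ?thesis
          using \<open>f2 \<rho>2 = 0\<close> by (simp add: g_def)
      next
        case False
        then show ?thesis
          using \<open>0 \<le> B\<close> MX d by (simp add: g_def)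
      qed
      then show ?thesis
        using False \<open>0 \<le> e\<close> by (simp add: g_def)
    qed
  qed
  show "\<bar>(if x \<le> \<rho>1 then v1 x else 0) - (if x \<le> \<rho>2 then v2 x else 0)\<bar> \<le> K * M\<^sub>X * \<bar>v1 0 - v2 0\<bar>"
    if "0 \<le> x"
  proof -
    \<comment> \<open>For the profiles themselves the error at equal levels is 0.\<close>
    have "\<bar>v1 (w1.position y) - v2 (w2.position y)\<bar> \<le> 0" if "0 \<le> y" "y \<le> v1 0" for y
      using that range w1.v_position[of y] w2.v_position[of y] by simp
    from compare[OF w2.v_lipschitz[folded K_def] w2.v_end K order.refl \<open>0 \<le> x\<close> this]
    show ?thesis by (simp add: d_def mult.assoc)
  qed
  show "\<bar>(if x \<le> \<rho>1 then w1 x else 0) - (if x \<le> \<rho>2 then w2 x else 0)\<bar>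
      \<le> (M\<^sub>c * K / (\<Lambda> * \<mu>) + (C * K + 1) / \<Lambda> * M\<^sub>X) * \<bar>v1 0 - v2 0\<bar>"
    if "0 \<le> x"
  proof -
    have level: "\<bar>w1 (w1.position y) - w2 (w2.position y)\<bar> \<le> M\<^sub>c * K / (\<Lambda> * \<mu>) * d"
      if y: "0 \<le> y" "y \<le> v1 0" for y
    proof -
      have y2: "y \<le> v2 0" using y range by simp
      have "w1.speed y - w2.speed y \<le> (c2 - c1) * K / (\<Lambda> * \<mu>) * y"
        unfolding K_def by (rule phase_speed_diff[OF orbit1 orbit2 c_mono mu(1) mu2 y y2])
      also have "\<dots> \<le> (M\<^sub>c * d) * K / (\<Lambda> * \<mu>) * 1"
        using c_diff c_mono K mu o1.Lambda y y2 o2.V Mc d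
        by (intro mult_mono divide_right_mono mult_right_mono) auto
      finally have "w1.speed y - w2.speed y \<le> M\<^sub>c * K / (\<Lambda> * \<mu>) * d"
        by (simp add: mult_ac)
      moreover have "w2.speed y \<le> w1.speed y"
        by (rule phase_speed_antimono[OF orbit1 orbit2 c_mono y y2])
      ultimately show ?thesis
        by (simp add: w1.speed_def w2.speed_def)
    qed
    have lip: "\<bar>w2 x - w2 y\<bar> \<le> (C * K + 1) / \<Lambda> * \<bar>x - y\<bar>" if "x \<in> {0..\<rho>2}" "y \<in> {0..\<rho>2}" for x y
    proof -
      have "\<bar>w2 x - w2 y\<bar> \<le> (c2 * K + 1) / \<Lambda> * \<bar>x - y\<bar>"
        unfolding K_def by (rule w2.w_lipschitz[OF that])
      also have "\<dots> \<le> (C * K + 1) / \<Lambda> * \<bar>x - y\<bar>"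
        using C K o1.Lambda by (intro mult_right_mono divide_right_mono add_right_mono) auto
      finally show ?thesis .
    qed
    have "0 \<le> M\<^sub>c * K / (\<Lambda> * \<mu>) * d"
      using Mc K mu o1.Lambda d by simp
    from compare[OF lip w2.w_end L this \<open>0 \<le> x\<close> level]
    show ?thesis by (simp add: d_def distrib_right mult.assoc)
  qed
qed

section \<open>Solutions of the free boundary problem\<close>

lemma nth_deriv_on_0 [simp]: "nth_deriv_on S 0 f = f"
  by (simp add: nth_deriv_on_def)

lemma nth_deriv_on_Suc:
  "nth_deriv_on S (Suc k) f x = vector_derivative (nth_deriv_on S k f) (at x within S)"
  by (simp add: nth_deriv_on_def)

lemma C_k_on_has_derivative:
  assumes "C_k_on k S f" "j < k" "x \<in> S"
  shows "(nth_deriv_on S j f has_real_derivative nth_deriv_on S (Suc j) f x) (at x within S)"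
  using assms unfolding nth_deriv_on_Suc has_real_derivative_iff_has_vector_derivative C_k_on_def
  by (simp add: vector_derivative_works)

text \<open>The summand 1 forces \<mu> \<le> 1, so \<mu>^2 \<le> \<mu> and the quadratic condition
  follows from (\<Lambda> + C) \<mu> \<le> 1.\<close>

lemma barrier_slope_le:
  fixes \<Lambda> C c :: real
  assumes "0 < \<Lambda>" "0 \<le> C"
  defines "\<mu> \<equiv> 1 / (\<Lambda> + C + 1)"
  shows "0 < \<mu>" "\<Lambda> * \<mu>\<^sup>2 + C * \<mu> \<le> 1"
proof -
  show pos: "0 < \<mu>" using assms by simp
  have "\<mu> \<le> 1" using assms by simp
  then have "\<Lambda> * \<mu>\<^sup>2 \<le> \<Lambda> * \<mu>"
    using pos assms(1,2) by (simp add: power2_eq_square mult_left_le)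
  moreover have "\<Lambda> * \<mu> + C * \<mu> \<le> 1"
    using assms by (simp add: \<mu>_def flip: distrib_right add_divide_distrib)
  ultimately show "\<Lambda> * \<mu>\<^sup>2 + C * \<mu> \<le> 1" by linarith
qed

lemma continuous_on_if_lipschitz:
  fixes f :: "real \<Rightarrow> real"
  assumes "\<And>x y. x \<in> S \<Longrightarrow> y \<in> S \<Longrightarrow> \<bar>f x - f y\<bar> \<le> B * \<bar>x - y\<bar>" "0 \<le> B"
  shows "continuous_on S f"
  using assms by (intro lipschitz_on_continuous_on[of B] lipschitz_onI) (auto simp: dist_real_def)

section \<open>Positivity of a solution up to its free boundary, and a bound for its speed\<close>

locale free_boundary =
  fixes \<alpha> \<Lambda> v\<^sub>0 c R :: real and v :: "real \<Rightarrow> real"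
  assumes sol: "fbp_solution \<alpha> \<Lambda> v\<^sub>0 c R v"
    and alpha: "0 < \<alpha>" "\<alpha> < 1" and Lambda: "0 < \<Lambda>" and v0: "0 < v\<^sub>0" "v\<^sub>0 \<le> 1"
begin

definition v' :: "real \<Rightarrow> real" where
  "v' = nth_deriv_on {0..R} 1 v"

lemma sol_facts:
  shows c: "0 < c" and R: "0 < R" and v_nonneg: "\<And>x. x \<in> {0..R} \<Longrightarrow> 0 \<le> v x"
    and smooth: "C_inf_on {0..<R} v"
    and ode: "\<And>x. x \<in> {0<..<R} \<Longrightarrow> \<Lambda> * nth_deriv_on {0..R} 2 v x - c * v' x = v x powr \<alpha>"
    and v_start: "v 0 = v\<^sub>0" and v'_start: "v' 0 = - (c / \<Lambda>) * (1 - v\<^sub>0)"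
    and v_end: "v R = 0" and v'_end: "v' R = 0"
  using sol by (auto simp: fbp_solution_def Let_def v'_def)

lemma C2: "C_k_on (2 + nat \<lfloor>2 * \<alpha> / (1 - \<alpha>)\<rfloor>) {0..R} v"
  using sol by (simp add: fbp_solution_def C_Hoelder_on_def Let_def)

lemma der_v_within: "x \<in> {0..R} \<Longrightarrow> (v has_real_derivative v' x) (at x within {0..R})"
  using C_k_on_has_derivative[OF C2, of 0 x] by (simp add: v'_def)

lemma der_v'_within:
  "x \<in> {0..R} \<Longrightarrow> (v' has_real_derivative nth_deriv_on {0..R} 2 v x) (at x within {0..R})"
  using C_k_on_has_derivative[OF C2, of 1 x] by (simp add: v'_def numeral_2_eq_2)

lemma cont_v: "continuous_on {0..R} v"
  using der_v_within by (meson DERIV_continuous continuous_on_eq_continuous_within)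

lemma cont_v': "continuous_on {0..R} v'"
  using der_v'_within by (meson DERIV_continuous continuous_on_eq_continuous_within)

lemma der_v: "0 < x \<Longrightarrow> x < R \<Longrightarrow> (v has_real_derivative v' x) (at x)"
  using der_v_within[of x] at_within_Icc_at[of 0 x R] by simp

lemma der_v':
  assumes "0 < x" "x < R"
  shows "(v' has_real_derivative (c * v' x + v x powr \<alpha>) / \<Lambda>) (at x)"
proof -
  have "nth_deriv_on {0..R} 2 v x = (c * v' x + v x powr \<alpha>) / \<Lambda>"
    using ode[of x] assms Lambda by (simp add: field_simps)
  then show ?thesis
    using der_v'_within[of x] at_within_Icc_at[of 0 x R] assms by simp
qed

text \<open>The same integrating factor as for \<open>w_pos\<close>. As v is so far only known to be
  nonnegative, it yields the weak inequality; strictness has to wait until zeros before R are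
  excluded.\<close>

lemma v'_nonpos:
  assumes "x \<in> {0..R}"
  shows "v' x \<le> 0"
proof -
  define g where "g = (\<lambda>x. exp (- (c / \<Lambda>) * x) * v' x)"
  define g' where "g' = (\<lambda>x. exp (- (c / \<Lambda>) * x) * (- (c / \<Lambda>) * 1) * v' x
    + (c * v' x + v x powr \<alpha>) / \<Lambda> * exp (- (c / \<Lambda>) * x))"
  have "g x \<le> g R"
  proof (rule le_if_deriv_nonneg[of x R g g'])
    show "continuous_on {x..R} g"
      unfolding g_def using assms
      by (intro continuous_intros continuous_on_subset[OF cont_v']) auto
    show "(g has_real_derivative g' t) (at t)" if "x < t" "t < R" for t
    proof -
      have "((\<lambda>x. exp (- (c / \<Lambda>) * x)) has_real_derivative exp (- (c / \<Lambda>) * t) * (- (c / \<Lambda>) * 1)) (at t)"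
        by (intro DERIV_fun_exp DERIV_cmult DERIV_ident)
      then show ?thesis
        unfolding g_def g'_def using that assms by (intro DERIV_mult der_v') auto
    qed
    show "0 \<le> g' t" if "x < t" "t < R" for t
    proof -
      have "g' t = exp (- (c / \<Lambda>) * t) * v t powr \<alpha> / \<Lambda>"
        by (simp add: g'_def add_divide_distrib algebra_simps)
      then show ?thesis
        using Lambda by simp
    qed
  qed (use assms in auto)
  then show ?thesis
    by (simp add: g_def v'_end mult_le_0_iff)
qed

lemma wave_profile_upto:
  assumes z: "0 < z" "z \<le> R" and pos: "\<And>x. 0 \<le> x \<Longrightarrow> x < z \<Longrightarrow> 0 < v x"
    and "v z = 0" "v' z = 0"
  shows "wave_profile \<alpha> \<Lambda> c z v (\<lambda>x. - v' x)"
proof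
  show "continuous_on {0..z} v" "continuous_on {0..z} (\<lambda>x. - v' x)"
    using z by (auto intro!: continuous_intros continuous_on_subset[OF cont_v] continuous_on_subset[OF cont_v'])
  show "(v has_real_derivative - (- v' x)) (at x)" if "0 < x" "x < z" for x
    using der_v[of x] that z by simp
  show "((\<lambda>x. - v' x) has_real_derivative (c * - v' x - v x powr \<alpha>) / \<Lambda>) (at x)" if "0 < x" "x < z" for x
  proof (rule DERIV_cong)
    show "((\<lambda>x. - v' x) has_real_derivative - ((c * v' x + v x powr \<alpha>) / \<Lambda>)) (at x)"
      using that z by (intro DERIV_minus der_v') auto
    show "- ((c * v' x + v x powr \<alpha>) / \<Lambda>) = (c * - v' x - v x powr \<alpha>) / \<Lambda>"
      using Lambda by (simp add: field_simps)
  qed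
qed (use assms alpha Lambda c v_start v0 in auto)

text \<open>If \<^term>\<open>v\<close> vanished before \<^term>\<open>R\<close>, then by smoothness it would be flat to infinite order at its first
  zero, whereas a profile decays there only like the power \<open>2 / (1 - \<alpha>)\<close> of the distance.\<close>

lemma no_early_zero:
  assumes z: "0 < z" "z < R" and pos: "\<And>x. 0 \<le> x \<Longrightarrow> x < z \<Longrightarrow> 0 < v x"
    and zero: "\<And>x. z \<le> x \<Longrightarrow> x < R \<Longrightarrow> v x = 0"
  shows False
proof -
  \<comment> \<open>Smoothness of all orders is available on [0,R) only; since z < R, these
    derivatives are two-sided near z.\<close>
  define E where "E = (\<lambda>k. nth_deriv_on {0..<R} k v)"
  have der_E: "(E k has_real_derivative E (Suc k) x) (at x)" if "0 < x" "x < R" for k x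
  proof -
    have "(E k has_real_derivative E (Suc k) x) (at x within {0..<R})"
      unfolding E_def using smooth that
      by (intro C_k_on_has_derivative[of "Suc k"]) (auto simp: C_inf_on_def)
    moreover have "at x within {0..<R} = at x"
      using that by (intro at_within_interior) auto
    ultimately show ?thesis by simp
  qed
  have E_0: "E 0 = v" by (simp add: E_def)
  have E_zero: "E k x = 0" if "z < x" "x < R" for k x
    using that
  proof (induction k arbitrary: x)
    case 0
    then show ?case using zero by (simp add: E_0)
  next
    case (Suc k)
    have "((\<lambda>_. 0) has_real_derivative E (Suc k) x) (at x)"
      by (rule has_field_derivative_transform_within_open[of "E k" _ _ "{z<..<R}"])
        (use Suc z in \<open>auto intro: der_E\<close>)
    then show ?case
      using DERIV_unique DERIV_const by blast
  qed
  \<comment> \<open>The zero z is an interior minimum of the nonnegative v, so v restricted to [0,z]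
    is itself a wave profile.\<close>
  have "v' z = 0"
  proof (rule DERIV_local_min)
    show "(v has_real_derivative v' z) (at z)" using z by (intro der_v)
    show "0 < min z (R - z)" using z by simp
    show "\<forall>y. \<bar>z - y\<bar> < min z (R - z) \<longrightarrow> v z \<le> v y"
    proof (intro allI impI)
      fix y assume "\<bar>z - y\<bar> < min z (R - z)"
      then have "y \<in> {0..R}" by auto
      then show "v z \<le> v y" using zero[of z] z v_nonneg[of y] by simp
    qed
  qed
  then interpret wave_profile \<alpha> \<Lambda> c z v "\<lambda>x. - v' x"
    using z pos zero[of z] by (intro wave_profile_upto) auto
  interpret phase_orbit \<alpha> \<Lambda> c "v 0" position speed by (rule phase_orbit_profile)
  define k where "k = (1 - \<alpha>) / 2"
  have k: "0 < k" using alpha by (simp add: k_def)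
  \<comment> \<open>The order n is chosen with n k \<ge> 2: then v \<le> const \<delta>^n at
    distance \<delta> \<le> 1 before z gives v^k \<le> const \<delta>^2, against the lower bound v^k
    \<ge> \<mu> k \<delta> from \<open>X_drop\<close>.\<close>
  define n where "n = nat \<lceil>2 / k\<rceil>"
  have n: "2 / k \<le> real n" unfolding n_def by linarith
  have "0 < 2 / k" using k by simp
  then have "0 < n" using n by (cases n) auto
  have nk: "2 \<le> real n * k" using n k by (simp add: pos_divide_le_eq)
  define \<mu> where "\<mu> = 1 / (\<Lambda> + c + 1)"
  have mu: "0 < \<mu>" "\<Lambda> * \<mu>\<^sup>2 + c * \<mu> \<le> 1"
    unfolding \<mu>_def using barrier_slope_le[of \<Lambda> c] Lambda c by auto
  have "compact (E n ` {z / 2..(z + R) / 2})"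
  proof (intro compact_continuous_image compact_Icc)
    show "continuous_on {z / 2..(z + R) / 2} (E n)"
      by (rule DERIV_atLeastAtMost_imp_continuous_on, rule exI, rule der_E) (use z in auto)
  qed
  then have "bounded (E n ` {z / 2..(z + R) / 2})"
    by (rule compact_imp_bounded)
  then obtain M where M: "0 < M" "\<And>x. x \<in> {z / 2..(z + R) / 2} \<Longrightarrow> \<bar>E n x\<bar> \<le> M"
    unfolding bounded_pos by auto
  define B where "B = (M * 2 ^ n) powr k"
  have B: "0 < B" using M by (simp add: B_def)
  have small: "\<mu> * k \<le> B * \<delta>" if d: "0 < \<delta>" "\<delta> \<le> 1" "\<delta> \<le> z / 2" "\<delta> \<le> (R - z) / 2" for \<delta>
  proof -
    define x where "x = z - \<delta>"
    have x: "0 < x" "z / 2 \<le> x" "x < z" using d z by (auto simp: x_def)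
    \<comment> \<open>Expanding about z + \<delta>, inside the region where v vanishes, makes every
      Taylor coefficient 0; the distance to x is then 2 \<delta>, whence the factor 2^n in
      \<open>B\<close>.\<close>
    have "\<exists>t>x. t < z + \<delta> \<and> v x = (\<Sum>m<n. E m (z + \<delta>) / fact m * (x - (z + \<delta>)) ^ m)
        + E n t / fact n * (x - (z + \<delta>)) ^ n"
      using \<open>0 < n\<close> E_0 der_E x d z by (intro Taylor_down[where b = "z + \<delta>"]) (auto simp: x_def)
    then obtain t where t: "x < t" "t < z + \<delta>"
      and vx: "v x = (\<Sum>m<n. E m (z + \<delta>) / fact m * (x - (z + \<delta>)) ^ m)
        + E n t / fact n * (x - (z + \<delta>)) ^ n"
      by blast
    have "(\<Sum>m<n. E m (z + \<delta>) / fact m * (x - (z + \<delta>)) ^ m) = 0"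
      using E_zero[of "z + \<delta>"] d z by (intro sum.neutral) auto
    then have "v x = E n t / fact n * (x - (z + \<delta>)) ^ n"
      by (simp add: vx)
    then have "\<bar>v x\<bar> = \<bar>E n t\<bar> / fact n * \<bar>x - (z + \<delta>)\<bar> ^ n"
      by (simp add: abs_mult power_abs)
    also have "\<bar>x - (z + \<delta>)\<bar> = 2 * \<delta>"
      using d by (simp add: x_def)
    also have "\<bar>E n t\<bar> / fact n * (2 * \<delta>) ^ n \<le> M / 1 * (2 * \<delta>) ^ n"
      using M(2)[of t] M(1) t x d z by (intro mult_right_mono frac_le) (auto simp: field_simps)
    finally have "v x \<le> M * 2 ^ n * \<delta> ^ n"
      by (simp add: power_mult_distrib mult.assoc)
    then have "v x powr k \<le> (M * 2 ^ n * \<delta> ^ n) powr k"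
      using x z k v_range(1)[of x] by (intro powr_mono2) auto
    also have "\<dots> = B * \<delta> powr (real n * k)"
      using d M by (simp add: B_def powr_mult powr_powr flip: powr_realpow)
    also have "\<dots> \<le> B * \<delta> powr 2"
      using B d nk by (intro mult_left_mono powr_mono') auto
    finally have "v x powr k \<le> B * \<delta>\<^sup>2"
      using d by simp
    moreover have "\<delta> \<le> v x powr k / (\<mu> * k)"
      using X_drop[OF mu, of "v x"] v_range[of x] x position_0 position_v[of x]
      by (simp add: k_def x_def)
    ultimately have "\<delta> * (\<mu> * k) \<le> \<delta> * (B * \<delta>)"
      using mu k by (simp add: pos_le_divide_eq power2_eq_square mult_ac)
    then show ?thesis
      using d by (simp add: mult_le_cancel_left)
  qed
  \<comment> \<open>The second entry makes B \<delta> \<le> \<mu> k / 2, contradicting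
    \<open>small\<close>.\<close>
  define \<delta> where "\<delta> = min (min 1 (\<mu> * k / (2 * B))) (min (z / 2) ((R - z) / 2))"
  have "0 < \<delta>"
    using z mu k B by (simp add: \<delta>_def)
  moreover have "\<delta> \<le> 1" "\<delta> \<le> z / 2" "\<delta> \<le> (R - z) / 2"
    unfolding \<delta>_def by linarith+
  ultimately have "\<mu> * k \<le> B * \<delta>"
    by (rule small)
  also have "\<dots> \<le> B * (\<mu> * k / (2 * B))"
    using B by (intro mult_left_mono) (auto simp: \<delta>_def)
  also have "\<dots> = \<mu> * k / 2"
    using B by simp
  finally show False
    using mu k by simp
qed

text \<open>As v is nonincreasing and nonnegative, it would remain 0 from its first zero up to R,
  which is the situation excluded by \<open>no_early_zero\<close>.\<close>

lemma v_pos: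
  assumes "0 \<le> x" "x < R"
  shows "0 < v x"
proof (rule ccontr)
  assume "\<not> 0 < v x"
  then have "v x = 0" using v_nonneg[of x] assms by auto
  define A where "A = {0..R} \<inter> v -` {0}"
  have "compact A"
    unfolding A_def by (intro compact_vimage_Icc cont_v) auto
  moreover have "x \<in> A"
    using \<open>v x = 0\<close> assms by (simp add: A_def)
  ultimately obtain z where z: "z \<in> A" "\<And>t. t \<in> A \<Longrightarrow> z \<le> t"
    using compact_attains_inf[of A] by blast
  have "z \<le> x" using z(2) \<open>x \<in> A\<close> .
  have vz: "0 \<le> z" "z < R" "v z = 0"
    using z(1) \<open>z \<le> x\<close> assms by (auto simp: A_def)
  show False
  proof (rule no_early_zero)
    show "0 < z"
      using vz v_start v0 by (cases "z = 0") auto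
    show "0 < v t" if "0 \<le> t" "t < z" for t
    proof -
      have "t \<notin> A" using z(2)[of t] that by auto
      then show ?thesis
        using v_nonneg[of t] that vz by (auto simp: A_def)
    qed
    show "v t = 0" if t: "z \<le> t" "t < R" for t
    proof -
      have "- v z \<le> - v t"
      proof (rule le_if_deriv_nonneg[of z t "\<lambda>x. - v x" "\<lambda>x. - v' x"])
        show "continuous_on {z..t} (\<lambda>x. - v x)"
          using t vz by (intro continuous_on_minus continuous_on_subset[OF cont_v]) auto
        show "((\<lambda>x. - v x) has_real_derivative - v' x) (at x)" if "z < x" "x < t" for x
          using that t vz by (intro DERIV_minus der_v) auto
        show "0 \<le> - v' x" if "z < x" "x < t" for x
          using v'_nonpos[of x] that t vz by simp
      qed (use t in auto)
      then show ?thesis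
        using vz v_nonneg[of t] t by simp
    qed
  qed (use vz in auto)
qed

lemma profile: "wave_profile \<alpha> \<Lambda> c R v (\<lambda>x. - v' x)"
  using R v_pos v_end v'_end by (intro wave_profile_upto) auto

text \<open>The boundary condition makes the initial slope c (1 - v0) / \<Lambda>, while
  \<open>w_le\<close> bounds it independently of c; it remains to use v0 \<le> b < 1.\<close>

lemma speed_le:
  assumes "v\<^sub>0 \<le> b" "b < 1"
  shows "c \<le> sqrt (2 / (\<Lambda> * (1 + \<alpha>))) * \<Lambda> / (1 - b)"
proof -
  have "c / \<Lambda> * (1 - v\<^sub>0) \<le> sqrt (2 / (\<Lambda> * (1 + \<alpha>)))"
    using wave_profile.w_le[OF profile, of 0] R v'_start by simp
  moreover have "c / \<Lambda> * (1 - b) \<le> c / \<Lambda> * (1 - v\<^sub>0)"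
    using assms c Lambda by (intro mult_left_mono) auto
  ultimately have "c / \<Lambda> * (1 - b) \<le> sqrt (2 / (\<Lambda> * (1 + \<alpha>)))"
    by (rule order.trans[rotated])
  then show ?thesis
    using assms Lambda by (simp add: field_simps)
qed

end

section \<open>Continuous dependence\<close>

text \<open>The derivatives within [0,R] and within [R,L] are glued; at R they agree because both f
  and f' vanish there.\<close>

lemma has_derivative_zero_extension:
  fixes f f' :: "real \<Rightarrow> real"
  assumes der: "\<And>x. x \<in> {0..R} \<Longrightarrow> (f has_real_derivative f' x) (at x within {0..R})"
    and ends: "f R = 0" "f' R = 0" and R: "0 \<le> R" "R \<le> L" and x: "x \<in> {0..L}"
  shows "((\<lambda>x. if x \<le> R then f x else 0) has_real_derivative (if x \<le> R then f' x else 0))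
    (at x within {0..L})"
proof -
  define g where "g = (\<lambda>x. if x \<le> R then f x else 0)"
  define D where "D = (if x \<le> R then f' x else 0)"
  have left: "(g has_real_derivative D) (at x within {0..R})"
  proof (cases "x \<le> R")
    case True
    have "(g has_real_derivative f' x) (at x within {0..R})"
      by (rule has_field_derivative_transform_within[OF der zero_less_one])
        (use True x in \<open>auto simp: g_def\<close>)
    then show ?thesis
      using True by (simp add: D_def)
  next
    case False
    \<comment> \<open>A point outside the closed piece is not a limit point of it, so any derivative
      within that piece holds vacuously.\<close>
    then have "at x within {0..R} = bot"
      by (intro not_in_closure_trivial_limitI) simp
    then show ?thesis
      by (simp add: has_field_derivative_iff)
  qed
  have right: "(g has_real_derivative D) (at x within {R..L})"
  proof (cases "R \<le> x")
    case True
    then have "D = 0" using ends by (auto simp: D_def)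
    have "(g has_real_derivative 0) (at x within {R..L})"
      by (rule has_field_derivative_transform_within[OF DERIV_const zero_less_one])
        (use True x ends in \<open>auto simp: g_def\<close>)
    then show ?thesis
      using \<open>D = 0\<close> by simp
  next
    case False
    then have "at x within {R..L} = bot"
      by (intro not_in_closure_trivial_limitI) simp
    then show ?thesis
      by (simp add: has_field_derivative_iff)
  qed
  have "{0..L} = {0..R} \<union> {R..L}"
    using R by auto
  then show ?thesis
    using left right unfolding g_def D_def has_field_derivative_iff
    by (simp add: at_within_union filterlim_sup)
qed

context free_boundary
begin

lemma zero_ext_derivative:
  assumes L: "R \<le> L" and x: "x \<in> {0..L}"
  shows "(zero_ext L R v has_real_derivative (if x \<le> R then v' x else 0)) (at x within {0..L})"
  by (rule has_field_derivative_transform_within[OF has_derivative_zero_extension zero_less_one])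
    (use assms R der_v_within v_end v'_end in \<open>auto simp: zero_ext_def\<close>)

lemma nth_deriv_zero_ext:
  assumes L: "R \<le> L" and x: "x \<in> {0..L}"
  shows "nth_deriv_on {0..L} (Suc 0) (zero_ext L R v) x = (if x \<le> R then v' x else 0)"
  unfolding nth_deriv_on_Suc nth_deriv_on_0
  by (rule vector_derivative_within_closed_interval)
    (use assms R zero_ext_derivative[OF assms] in \<open>auto simp: has_real_derivative_iff_has_vector_derivative\<close>)

lemma zero_ext_C1:
  assumes L: "R \<le> L"
  shows "zero_ext L R v \<in> C1_space L"
proof -
  interpret wave_profile \<alpha> \<Lambda> c R v "\<lambda>x. - v' x" by (rule profile)
  define B where "B = (c * sqrt (2 / (\<Lambda> * (1 + \<alpha>))) + 1) / \<Lambda>"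
  have B: "0 \<le> B" using alpha Lambda c by (simp add: B_def)
  have "continuous_on {0..L} (\<lambda>x. if x \<le> R then v' x else 0)"
  proof (rule continuous_on_if_lipschitz[OF abs_extension_diff_le B])
    show "\<bar>v' x - v' y\<bar> \<le> B * \<bar>x - y\<bar>" if "x \<in> {0..R}" "y \<in> {0..R}" for x y
      using w_lipschitz[OF that] by (simp add: B_def abs_minus_commute)
  qed (use v'_end R B in auto)
  then have "continuous_on {0..L} (nth_deriv_on {0..L} (Suc 0) (zero_ext L R v))"
    by (subst continuous_on_cong[OF refl nth_deriv_zero_ext[OF L]])
  moreover have "zero_ext L R v differentiable at x within {0..L}" if "x \<in> {0..L}" for x
    using zero_ext_derivative[OF L that] real_differentiable_def by blast
  moreover have "zero_ext L R v \<in> extensional {0..L}"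
    by (simp add: zero_ext_def)
  ultimately show ?thesis
    by (simp add: C1_space_def C_k_on_def)
qed

end

lemma C1_dist_le:
  assumes "f \<in> C1_space L" "g \<in> C1_space L" "0 \<le> L"
    and "\<And>x. x \<in> {0..L} \<Longrightarrow> \<bar>f x - g x\<bar> \<le> e"
    and "\<And>x. x \<in> {0..L} \<Longrightarrow>
      \<bar>nth_deriv_on {0..L} (Suc 0) f x - nth_deriv_on {0..L} (Suc 0) g x\<bar> \<le> e'"
  shows "C1_dist L f g \<le> e + e'"
  using assms by (auto simp: C1_dist_def intro!: add_mono cSUP_least)

text \<open>Each constant uses only earlier ones: \<open>K\<close> bounds slopes for every speed,
  \<open>C\<close> then bounds the speeds, \<open>\<mu>\<close> is a barrier factor valid for all
  speeds up to \<open>C\<close>, and \<open>L\<close> bounds the widths. For s = t the estimates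
  contain uniqueness of c, R and the extension.\<close>

lemma free_boundary_lipschitz:
  fixes \<alpha> \<Lambda> a b :: real
  assumes params: "0 < \<alpha>" "\<alpha> < 1" "0 < \<Lambda>" "0 < a" "b < 1"
  obtains L M where "0 < L" "0 \<le> M"
    "\<And>s c R v. fbp_solution \<alpha> \<Lambda> s c R v \<Longrightarrow> a \<le> s \<Longrightarrow> s \<le> b \<Longrightarrow> R \<le> L \<and> zero_ext L R v \<in> C1_space L"
    "\<And>s c R v t d S u. fbp_solution \<alpha> \<Lambda> s c R v \<Longrightarrow> fbp_solution \<alpha> \<Lambda> t d S u \<Longrightarrow> a \<le> s \<Longrightarrow> s \<le> t \<Longrightarrow> t \<le> b \<Longrightarrow>
      \<bar>c - d\<bar> \<le> M * \<bar>s - t\<bar> \<and> \<bar>R - S\<bar> \<le> M * \<bar>s - t\<bar> \<and>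
      C1_dist L (zero_ext L R v) (zero_ext L S u) \<le> M * \<bar>s - t\<bar>"
proof -
  define K where "K = sqrt (2 / (\<Lambda> * (1 + \<alpha>)))"
  define C where "C = K * \<Lambda> / (1 - b)"
  define \<mu> where "\<mu> = 1 / (\<Lambda> + C + 1)"
  define L where "L = 1 / (\<mu> * ((1 - \<alpha>) / 2))"
  define M\<^sub>c where "M\<^sub>c = 1 / (\<mu> * a * (1 - b))"
  define M\<^sub>X where "M\<^sub>X = M\<^sub>c * K / (\<Lambda> * \<mu>) / (\<mu>\<^sup>2 * (1 - \<alpha>)) + 1 / (\<mu> * a)"
  define M\<^sub>w where "M\<^sub>w = M\<^sub>c * K / (\<Lambda> * \<mu>) + (C * K + 1) / \<Lambda> * M\<^sub>X"
  have K: "0 \<le> K" using params by (simp add: K_def)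
  have C: "0 \<le> C" using params K by (simp add: C_def)
  have mu: "0 < \<mu>" "\<Lambda> * \<mu>\<^sup>2 + C * \<mu> \<le> 1"
    unfolding \<mu>_def using barrier_slope_le[of \<Lambda> C] params C by auto
  have L: "0 < L" using mu params by (simp add: L_def)
  have M_nonneg: "0 \<le> M\<^sub>c" "0 \<le> M\<^sub>X" "0 \<le> M\<^sub>w"
  proof -
    show Mc: "0 \<le> M\<^sub>c" using params mu by (simp add: M\<^sub>c_def)
    show MX: "0 \<le> M\<^sub>X" using Mc K params mu by (simp add: M\<^sub>X_def)
    show "0 \<le> M\<^sub>w" using Mc MX K C params mu by (simp add: M\<^sub>w_def)
  qed
  define M where "M = M\<^sub>c + M\<^sub>X + (K * M\<^sub>X + M\<^sub>w)"
  have M: "0 \<le> M" "M\<^sub>c \<le> M" "M\<^sub>X \<le> M" "K * M\<^sub>X + M\<^sub>w \<le> M"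
    using M_nonneg K by (auto simp: M_def)
  have fb: "free_boundary \<alpha> \<Lambda> s c R v" if "fbp_solution \<alpha> \<Lambda> s c R v" "a \<le> s" "s \<le> b" for s c R v
    using that params by unfold_locales auto
  have c_le: "c \<le> C" if "fbp_solution \<alpha> \<Lambda> s c R v" "a \<le> s" "s \<le> b" for s c R v
    using free_boundary.speed_le[OF fb[OF that]] that params by (simp add: C_def K_def)
  have R_le: "R \<le> L" if "fbp_solution \<alpha> \<Lambda> s c R v" "a \<le> s" "s \<le> b" for s c R v
  proof -
    have "\<Lambda> * \<mu>\<^sup>2 + c * \<mu> \<le> 1"
      using mu mult_right_mono[OF c_le[OF that], of \<mu>] by linarith
    then show ?thesis
      using wave_profile.width_le[OF free_boundary.profile[OF fb[OF that]] mu(1)] by (simp add: L_def)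
  qed
  show thesis
  proof (rule that[OF L M(1)])
    show "R \<le> L \<and> zero_ext L R v \<in> C1_space L"
      if sol: "fbp_solution \<alpha> \<Lambda> s c R v" "a \<le> s" "s \<le> b" for s c R v
      using R_le[OF that] free_boundary.zero_ext_C1[OF fb[OF that]] by blast
    show "\<bar>c - d\<bar> \<le> M * \<bar>s - t\<bar> \<and> \<bar>R - S\<bar> \<le> M * \<bar>s - t\<bar> \<and>
        C1_dist L (zero_ext L R v) (zero_ext L S u) \<le> M * \<bar>s - t\<bar>"
      if sols: "fbp_solution \<alpha> \<Lambda> s c R v" "fbp_solution \<alpha> \<Lambda> t d S u" and "a \<le> s" "s \<le> t" "t \<le> b"
      for s c R v t d S u
    proof -
      have "s \<le> b" "a \<le> t" using that by auto
      interpret f1: free_boundary \<alpha> \<Lambda> s c R v by (rule fb) fact+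
      interpret f2: free_boundary \<alpha> \<Lambda> t d S u by (rule fb) fact+
      have ends: "R \<le> L" "S \<le> L" "d \<le> C"
        using R_le[OF sols(1) \<open>a \<le> s\<close> \<open>s \<le> b\<close>] R_le[OF sols(2) \<open>a \<le> t\<close> \<open>t \<le> b\<close>]
          c_le[OF sols(2) \<open>a \<le> t\<close> \<open>t \<le> b\<close>] by auto
      have bc: "- f1.v' 0 = c * (1 - v 0) / \<Lambda>" "- f2.v' 0 = d * (1 - u 0) / \<Lambda>"
        by (simp_all add: f1.v'_start f2.v'_start f1.v_start f2.v_start)
      have range: "a \<le> v 0" "v 0 \<le> u 0" "u 0 \<le> b"
        using that by (simp_all add: f1.v_start f2.v_start)
      note cmp = wave_profile_compare[OF f1.profile f2.profile bc \<open>0 < a\<close> range \<open>b < 1\<close> mu ends(3),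
          folded K_def, folded M\<^sub>c_def, folded M\<^sub>X_def, folded M\<^sub>w_def, unfolded f1.v_start f2.v_start]
      have scale: "r \<le> M * \<bar>s - t\<bar>" if "r \<le> m * \<bar>s - t\<bar>" "m \<le> M" for r m
        using that mult_right_mono[OF that(2), of "\<bar>s - t\<bar>"] by simp
      have "C1_dist L (zero_ext L R v) (zero_ext L S u) \<le> K * M\<^sub>X * \<bar>s - t\<bar> + M\<^sub>w * \<bar>s - t\<bar>"
      proof (rule C1_dist_le)
        show "zero_ext L R v \<in> C1_space L" "zero_ext L S u \<in> C1_space L" "0 \<le> L"
          using f1.zero_ext_C1 f2.zero_ext_C1 ends L by auto
        show "\<bar>zero_ext L R v x - zero_ext L S u x\<bar> \<le> K * M\<^sub>X * \<bar>s - t\<bar>" if "x \<in> {0..L}" for x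
          using cmp(3)[of x] that by (simp add: zero_ext_def)
        show "\<bar>nth_deriv_on {0..L} (Suc 0) (zero_ext L R v) x
            - nth_deriv_on {0..L} (Suc 0) (zero_ext L S u) x\<bar> \<le> M\<^sub>w * \<bar>s - t\<bar>" if "x \<in> {0..L}" for x
        proof -
          have "\<bar>(if x \<le> R then - f1.v' x else 0) - (if x \<le> S then - f2.v' x else 0)\<bar> \<le> M\<^sub>w * \<bar>s - t\<bar>"
            using cmp(4)[of x] that by simp
          then have "\<bar>(if x \<le> R then f1.v' x else 0) - (if x \<le> S then f2.v' x else 0)\<bar> \<le> M\<^sub>w * \<bar>s - t\<bar>"
            by (auto simp: abs_le_iff)
          then show ?thesis
            using f1.nth_deriv_zero_ext[OF ends(1) that] f2.nth_deriv_zero_ext[OF ends(2) that] by simp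
        qed
      qed
      then have "C1_dist L (zero_ext L R v) (zero_ext L S u) \<le> (K * M\<^sub>X + M\<^sub>w) * \<bar>s - t\<bar>"
        by (simp add: distrib_right)
      then show ?thesis
        using scale[OF cmp(1) M(2)] scale[OF cmp(2) M(3)] scale[OF _ M(4)] by blast
    qed
  qed
qed

text \<open>The bound is chosen before the family of solutions, so it depends on \<alpha>,
  \<Lambda>, a and b alone. The family is an arbitrary choice of solutions, one for each datum, and
  thus covers the unique ones.\<close>

theorem corollary3p2:
  fixes \<alpha> \<Lambda> a b :: real
  assumes "0 < \<alpha>" "\<alpha> < 1" "\<Lambda> > 0" "0 < a" "a < b" "b < 1"
  shows "\<exists>R\<^sub>m\<^sub>a\<^sub>x>0. \<forall>(c :: real \<Rightarrow> real) (R :: real \<Rightarrow> real) (v :: real \<Rightarrow> real \<Rightarrow> real).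
    (\<forall>v\<^sub>0\<in>{a..b}. fbp_solution \<alpha> \<Lambda> v\<^sub>0 (c v\<^sub>0) (R v\<^sub>0) (v v\<^sub>0)) \<longrightarrow>
      (\<forall>v\<^sub>0\<in>{a..b}. 0 < R v\<^sub>0 \<and> R v\<^sub>0 \<le> R\<^sub>m\<^sub>a\<^sub>x) \<and>
      continuous_map (top_of_set {a..b})
        (prod_topology (top_of_set ({0<..} \<times> {0<..})) (C1_topology R\<^sub>m\<^sub>a\<^sub>x))
        (\<lambda>v\<^sub>0. ((c v\<^sub>0, R v\<^sub>0), zero_ext R\<^sub>m\<^sub>a\<^sub>x (R v\<^sub>0) (v v\<^sub>0)))"
proof -
  from free_boundary_lipschitz[OF assms(1-4) assms(6)] obtain L M where L: "0 < L" and M: "0 \<le> M"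
    and bound: "\<And>s c R v. fbp_solution \<alpha> \<Lambda> s c R v \<Longrightarrow> a \<le> s \<Longrightarrow> s \<le> b \<Longrightarrow>
      R \<le> L \<and> zero_ext L R v \<in> C1_space L"
    and lip: "\<And>s c R v t d S u. fbp_solution \<alpha> \<Lambda> s c R v \<Longrightarrow> fbp_solution \<alpha> \<Lambda> t d S u \<Longrightarrow>
      a \<le> s \<Longrightarrow> s \<le> t \<Longrightarrow> t \<le> b \<Longrightarrow>
      \<bar>c - d\<bar> \<le> M * \<bar>s - t\<bar> \<and> \<bar>R - S\<bar> \<le> M * \<bar>s - t\<bar> \<and>
      C1_dist L (zero_ext L R v) (zero_ext L S u) \<le> M * \<bar>s - t\<bar>"
    by blast
  interpret C1: Metric_space "C1_space L" "C1_dist L"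
    by (rule Metric_space_C1[OF L])
  have "(\<forall>v\<^sub>0\<in>{a..b}. 0 < R v\<^sub>0 \<and> R v\<^sub>0 \<le> L) \<and>
      continuous_map (top_of_set {a..b})
        (prod_topology (top_of_set ({0<..} \<times> {0<..})) (C1_topology L))
        (\<lambda>v\<^sub>0. ((c v\<^sub>0, R v\<^sub>0), zero_ext L (R v\<^sub>0) (v v\<^sub>0)))"
    if sol: "\<forall>v\<^sub>0\<in>{a..b}. fbp_solution \<alpha> \<Lambda> v\<^sub>0 (c v\<^sub>0) (R v\<^sub>0) (v v\<^sub>0)"
    for c R :: "real \<Rightarrow> real" and v :: "real \<Rightarrow> real \<Rightarrow> real"
  proof -
    define Z where "Z = (\<lambda>s. zero_ext L (R s) (v s))"
    have pos: "0 < c s" "0 < R s" if "s \<in> {a..b}" for s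
      using bspec[OF sol that] by (auto simp: fbp_solution_def Let_def)
    have le: "R s \<le> L" "Z s \<in> C1_space L" if "s \<in> {a..b}" for s
      using bound[OF bspec[OF sol that]] that by (auto simp: Z_def)
    have lips: "\<bar>c s - c t\<bar> \<le> M * \<bar>s - t\<bar>" "\<bar>R s - R t\<bar> \<le> M * \<bar>s - t\<bar>"
      "C1_dist L (Z s) (Z t) \<le> M * \<bar>s - t\<bar>" if "s \<in> {a..b}" "t \<in> {a..b}" for s t
    proof -
      \<comment> \<open>The estimates are available for ordered data; both sides are symmetric in s
        and t.\<close>
      have *: "\<bar>c s - c t\<bar> \<le> M * \<bar>s - t\<bar> \<and> \<bar>R s - R t\<bar> \<le> M * \<bar>s - t\<bar> \<and>
          C1_dist L (Z s) (Z t) \<le> M * \<bar>s - t\<bar>" if "s \<in> {a..b}" "t \<in> {a..b}" "s \<le> t" for s t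
        unfolding Z_def using that by (intro lip bspec[OF sol]) auto
      show "\<bar>c s - c t\<bar> \<le> M * \<bar>s - t\<bar>" "\<bar>R s - R t\<bar> \<le> M * \<bar>s - t\<bar>"
          "C1_dist L (Z s) (Z t) \<le> M * \<bar>s - t\<bar>"
        using *[of s t] *[of t s] that C1.commute[of "Z s" "Z t"]
        by (cases "s \<le> t"; simp add: abs_minus_commute)+
    qed
    have "continuous_map (top_of_set {a..b}) (top_of_set ({0<..} \<times> {0<..})) (\<lambda>s. (c s, R s))"
    proof -
      have "continuous_on {a..b} c" "continuous_on {a..b} R"
        by (rule continuous_on_if_lipschitz[OF lips(1) M], assumption+)
          (rule continuous_on_if_lipschitz[OF lips(2) M], assumption+)
      then have "continuous_on {a..b} (\<lambda>s. (c s, R s))"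
        by (rule continuous_on_Pair)
      then show ?thesis
        using pos by auto
    qed
    moreover have "continuous_map (top_of_set {a..b}) (C1_topology L) Z"
      unfolding C1_topology_def C1.continuous_map_to_metric
    proof (intro ballI allI impI)
      fix s and e :: real
      assume "s \<in> topspace (top_of_set {a..b})" "0 < e"
      then have s: "s \<in> {a..b}" by simp
      \<comment> \<open>M may be 0, so the radius divides by M + 1.\<close>
      define U where "U = {a..b} \<inter> ball s (e / (M + 1))"
      have "Z t \<in> C1.mball (Z s) e" if "t \<in> U" for t
      proof -
        have t: "t \<in> {a..b}" "\<bar>s - t\<bar> < e / (M + 1)"
          using that by (auto simp: U_def dist_real_def)
        have "C1_dist L (Z s) (Z t) \<le> M * \<bar>s - t\<bar>"
          by (rule lips(3)[OF s t(1)])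
        also have "\<dots> \<le> (M + 1) * \<bar>s - t\<bar>"
          by (intro mult_right_mono) auto
        also have "\<dots> < e"
          using t(2) M by (simp add: pos_less_divide_eq mult.commute)
        finally show ?thesis
          using le(2)[OF s] le(2)[OF t(1)] by simp
      qed
      moreover have "openin (top_of_set {a..b}) U"
        unfolding U_def by (intro openin_open_Int) simp
      moreover have "s \<in> U"
        using s M \<open>0 < e\<close> by (simp add: U_def)
      ultimately show "\<exists>U. openin (top_of_set {a..b}) U \<and> s \<in> U \<and> (\<forall>t\<in>U. Z t \<in> C1.mball (Z s) e)"
        by blast
    qed
    ultimately have "continuous_map (top_of_set {a..b})
        (prod_topology (top_of_set ({0<..} \<times> {0<..})) (C1_topology L)) (\<lambda>s. ((c s, R s), Z s))"
      by (simp add: continuous_map_paired)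
    then show ?thesis
      using pos(2) le(1) by (simp add: Z_def)
  qed
  with L show ?thesis by blast
qed

end
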